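(* Let $(X,Y,\mu,\nu,c)$ be a compact OT problem satisfying the strong uniqueness hypothesis (SU) and let $T_*:X\to Y$ be an optimal transport map. Then the following statements are equivalent: (i) $\mu[D(T_* )]=0$, where $D(T_* )\subset X$ is the set of points at which $T_*$ is discontinuous. (ii) $\operatorname{disc}_p(T_k,T_* )\to 0$ as $k\to\infty$ for every $1\le p<\infty$ whenever $(T_k)_k$ is an approximating sequence of projection maps for $(X,Y,\mu,\nu,c)$.
   Context: A compact OT problem is a quintuple $(X,Y,\mu,\nu,c)$ where $(X,d_X)$, $(Y,d_Y)$ are compact metric spaces, $\mu\in\mathcal{P}(X)$, $\nu\in\mathcal{P}(Y)$ are Borel probability measures and $c:X\times Y\to\mathbb{R}$ is continuous. $\mathcal{A}(\mu,\nu)$ is the set of Borel probability measures on $X\times Y$ with marginals $\mu,\nu$ (transport plans), and $\mathrm{K}[\pi]=\int c\,d\pi$. A transport map is a Borel map $T:X\to Y$ with $T_\#\mu=\nu$; it induces the plan $\pi_T=(\operatorname{Id}_X\times T)_\#\mu$, where $(\operatorname{Id}_X\times T)(x)=(x,T(x))$. An optimal transport plan minimizes $\mathrm{K}$ over $\mathcal{A}(\mu,\nu)$; an optimal transport map minimizes $\int_X c(x,T(x))\,d\mu(x)$ over transport maps. (SU): there is a unique optimal transport plan $\pi_*\in\mathcal{A}(\mu,\nu)$ and it is induced by a transport map $T_*$, i.e. $\pi_{T_*}=\pi_*$. (Then $T_*$ is an optimal transport map, unique up to $\mu$-null sets.) Discretization: for $h\ge 0$, an $h$-partition of a metric space $Z$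 is a finite family $\{(E_i,z_i)\}_{i\in I}$ where the $E_i$ are pairwise disjoint Borel sets covering $Z$, $z_i\in E_i$ and $\operatorname{diam}(E_i)\le h$. Given $h$-partitions $\{(E_i,x_i)\}_{i\in I}$ of $X$ and $\{(F_j,y_j)\}_{j\in J}$ of $Y$, put $\mu_i=\mu[E_i]$, $\nu_j=\nu[F_j]$. An $h$-plan is a family $\pi_h=(\pi_{ij})_{(i,j)\in I\times J}$ of nonnegative reals with $\sum_j\pi_{ij}=\mu_i$ for all $i$ and $\sum_i\pi_{ij}=\nu_j$ for all $j$, identified with the measure $\sum_{ij}\pi_{ij}\delta_{(x_i,y_j)}$. It is $\varepsilon$-optimal ($\varepsilon\ge 0$) if $\mathrm{K}[\pi_h]\le\varepsilon+\mathrm{K}[\tilde\pi_h]$ for every $h$-plan $\tilde\pi_h$ built from the same pair of $h$-partitions. An approximating sequence of discrete plans is a sequence $(\pi_k)_k$ such that each $\pi_k$ is an $\varepsilon_k$-optimal $h_k$-plan (partitions may vary with $k$) with $\varepsilon_k\to0$, $h_k\to 0$. Projection maps: given points $(y_j)_j$ in $Y$ (finitely many) and weights $w_j\ge0$, $\sum_jw_j=1$, let $V(y)=\sum_jw_jd_Y(y,y_j)$; $\hat y\in Y$ is an $\varepsilon$-approximate geometric median for $(y_j)_j$ with weights $(w_j)_j$ if $V(\hat y)\le V(y)+\varepsilon$ for all $y\in Y$. $(Y,d_Y)$ is normed if $Y$ is a convex subset of a vector space $\mathbb{V}$ and $d_Y$ is induced by a norm on $\mathbb{V}$; then the barycenter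 is $\sum_jw_jy_j\in Y$. Let $\pi_h$ be an $h$-plan and $T:X\to Y$ a Borel map which is constant on each $E_i$, with value $t_i$ on $E_i$. Let $I_+=\{i\in I:\mu_i>0\}$. For $Q\ge 0$: $T\in\mathcal{T}^Q_{GM}[\pi_h]$ if for all $i\in I_+$ the point $t_i$ is a $Qh$-approximate geometric median for $(y_j)_{j\in J}$ with weights $(\pi_{ij}/\mu_i)_{j\in J}$; when $(Y,d_Y)$ is normed, $T\in\mathcal{T}_B[\pi_h]$ if for all $i\in I_+$ the point $t_i$ is the barycenter of $(y_j)_{j\in J}$ with weights $(\pi_{ij}/\mu_i)_{j\in J}$ (if $Y$ is not normed, $\mathcal{T}_B[\pi_h]=\emptyset$). Set $\mathcal{T}^Q[\pi_h]=\mathcal{T}^Q_{GM}[\pi_h]\cup\mathcal{T}_B[\pi_h]$. An approximating sequence of projection maps is a sequence $(T_k)_k$ of Borel maps $X\to Y$ such that, for some fixed $Q\ge 0$ and some approximating sequence of discrete plans $(\pi_k)_k$, $T_k\in\mathcal{T}^Q[\pi_k]$ for all $k$. If $T_k$ is constructed from the $h_k$-partition $\{(E_i^k,x_i^k)\}_{i\in I_k}$ of $X$ (the one underlying $\pi_k$), then for any map $T:X\to Y$ $$\operatorname{disc}_p(T_k,T)=\Big(\sum_{i\in I_k}\mu[E_i^k]\,d_Y\big(T_k(x_i^k),T(x_i^k)\big)^p\Big)^{1/p}.$$ That is, $\operatorname{disc}_p(T_k,\cdot)$ is always evaluated with respect to the partition of $X$ used for constructing $T_k$. *)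

theory Defs
  imports "HOL-Probability.Probability"
begin

text \<open>
  A metric space is a subset \<open>X\<close> of a type of class \<open>metric_space\<close>, and its Borel sets are those of
  the subspace, \<open>restrict_space borel X\<close>. Values of maps and costs outside \<open>X\<close>, \<open>Y\<close> and \<open>X \<times> Y\<close>
  play no role.
\<close>

definition compact_OT_problem ::
    "'a::metric_space set \<Rightarrow> 'b::metric_space set \<Rightarrow> 'a measure \<Rightarrow> 'b measure \<Rightarrow> ('a \<times> 'b \<Rightarrow> real) \<Rightarrow> bool"
  where "compact_OT_problem X Y \<mu> \<nu> c \<longleftrightarrow>
    compact X \<and> compact Y \<and>
    prob_space \<mu> \<and> sets \<mu> = sets (restrict_space borel X) \<and>
    prob_space \<nu> \<and> sets \<nu> = sets (restrict_space borel Y) \<and>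
    continuous_on (X \<times> Y) c"

definition transport_plans ::
    "'a::metric_space set \<Rightarrow> 'b::metric_space set \<Rightarrow> 'a measure \<Rightarrow> 'b measure \<Rightarrow> ('a \<times> 'b) measure set"
  where "transport_plans X Y \<mu> \<nu> =
    {\<pi>. prob_space \<pi> \<and> sets \<pi> = sets (restrict_space borel (X \<times> Y)) \<and>
        distr \<pi> (restrict_space borel X) fst = \<mu> \<and>
        distr \<pi> (restrict_space borel Y) snd = \<nu>}"

definition K_cost :: "('a \<times> 'b \<Rightarrow> real) \<Rightarrow> ('a \<times> 'b) measure \<Rightarrow> real"
  where "K_cost c \<pi> = (LINT z|\<pi>. c z)"

definition optimal_plan ::
    "'a::metric_space set \<Rightarrow> 'b::metric_space set \<Rightarrow> 'a measure \<Rightarrow> 'b measure \<Rightarrow> ('a \<times> 'b \<Rightarrow> real)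
      \<Rightarrow> ('a \<times> 'b) measure \<Rightarrow> bool"
  where "optimal_plan X Y \<mu> \<nu> c \<pi> \<longleftrightarrow>
    \<pi> \<in> transport_plans X Y \<mu> \<nu> \<and> (\<forall>\<pi>' \<in> transport_plans X Y \<mu> \<nu>. K_cost c \<pi> \<le> K_cost c \<pi>')"

definition transport_maps ::
    "'a::metric_space set \<Rightarrow> 'b::metric_space set \<Rightarrow> 'a measure \<Rightarrow> 'b measure \<Rightarrow> ('a \<Rightarrow> 'b) set"
  where "transport_maps X Y \<mu> \<nu> =
    {T. T \<in> measurable (restrict_space borel X) (restrict_space borel Y) \<and>
        distr \<mu> (restrict_space borel Y) T = \<nu>}"

definition induced_plan ::
    "'a::metric_space set \<Rightarrow> 'b::metric_space set \<Rightarrow> 'a measure \<Rightarrow> ('a \<Rightarrow> 'b) \<Rightarrow> ('a \<times> 'b) measure"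
  where "induced_plan X Y \<mu> T = distr \<mu> (restrict_space borel (X \<times> Y)) (\<lambda>x. (x, T x))"

definition optimal_map ::
    "'a::metric_space set \<Rightarrow> 'b::metric_space set \<Rightarrow> 'a measure \<Rightarrow> 'b measure \<Rightarrow> ('a \<times> 'b \<Rightarrow> real)
      \<Rightarrow> ('a \<Rightarrow> 'b) \<Rightarrow> bool"
  where "optimal_map X Y \<mu> \<nu> c T \<longleftrightarrow>
    T \<in> transport_maps X Y \<mu> \<nu> \<and>
    (\<forall>S \<in> transport_maps X Y \<mu> \<nu>. (LINT x|\<mu>. c (x, T x)) \<le> (LINT x|\<mu>. c (x, S x)))"

definition strong_uniqueness ::
    "'a::metric_space set \<Rightarrow> 'b::metric_space set \<Rightarrow> 'a measure \<Rightarrow> 'b measure \<Rightarrow> ('a \<times> 'b \<Rightarrow> real) \<Rightarrow> bool"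
  where "strong_uniqueness X Y \<mu> \<nu> c \<longleftrightarrow>
    (\<exists>!\<pi>. optimal_plan X Y \<mu> \<nu> c \<pi>) \<and>
    (\<exists>\<pi>. optimal_plan X Y \<mu> \<nu> c \<pi> \<and> (\<exists>T \<in> transport_maps X Y \<mu> \<nu>. induced_plan X Y \<mu> T = \<pi>))"

definition discontinuities :: "'a::metric_space set \<Rightarrow> ('a \<Rightarrow> 'b::metric_space) \<Rightarrow> 'a set"
  where "discontinuities X T = {x \<in> X. \<not> continuous (at x within X) T}"

text \<open>
  The finite families carry arbitrary finite index sets of natural numbers; \<open>cell P i\<close>,
  \<open>tag P i\<close> and \<open>wt D i j\<close> are only meaningful for indices in these sets.
\<close>

record 'a tagged_partition =
  idx :: "nat set"
  cell :: "nat \<Rightarrow> 'a set"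
  tag :: "nat \<Rightarrow> 'a"

definition h_partition :: "'a::metric_space set \<Rightarrow> real \<Rightarrow> 'a tagged_partition \<Rightarrow> bool"
  where "h_partition Z h P \<longleftrightarrow>
    0 \<le> h \<and> finite (idx P) \<and> disjoint_family_on (cell P) (idx P) \<and> (\<Union>i\<in>idx P. cell P i) = Z \<and>
    (\<forall>i\<in>idx P. cell P i \<in> sets (restrict_space borel Z) \<and> tag P i \<in> cell P i \<and> diameter (cell P i) \<le> h)"

record ('a, 'b) discrete_plan =
  mesh :: real
  src :: "'a tagged_partition"
  tgt :: "'b tagged_partition"
  wt :: "nat \<Rightarrow> nat \<Rightarrow> real"

definition h_plan ::
    "'a::metric_space set \<Rightarrow> 'b::metric_space set \<Rightarrow> 'a measure \<Rightarrow> 'b measure \<Rightarrow> ('a, 'b) discrete_plan \<Rightarrow> bool"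
  where "h_plan X Y \<mu> \<nu> D \<longleftrightarrow>
    h_partition X (mesh D) (src D) \<and> h_partition Y (mesh D) (tgt D) \<and>
    (\<forall>i\<in>idx (src D). \<forall>j\<in>idx (tgt D). 0 \<le> wt D i j) \<and>
    (\<forall>i\<in>idx (src D). (\<Sum>j\<in>idx (tgt D). wt D i j) = measure \<mu> (cell (src D) i)) \<and>
    (\<forall>j\<in>idx (tgt D). (\<Sum>i\<in>idx (src D). wt D i j) = measure \<nu> (cell (tgt D) j))"

text \<open>The measure \<open>\<Sum>i j. \<pi>\<^sub>i\<^sub>j \<delta>(x\<^sub>i, y\<^sub>j)\<close>, as the image of a weighted counting measure on the indices.\<close>

definition plan_measure ::
    "'a::metric_space set \<Rightarrow> 'b::metric_space set \<Rightarrow> ('a, 'b) discrete_plan \<Rightarrow> ('a \<times> 'b) measure"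
  where "plan_measure X Y D =
    distr (point_measure (idx (src D) \<times> idx (tgt D)) (\<lambda>(i, j). ennreal (wt D i j)))
      (restrict_space borel (X \<times> Y)) (\<lambda>(i, j). (tag (src D) i, tag (tgt D) j))"

lemma K_cost_plan_measure:
  assumes "h_plan X Y \<mu> \<nu> D" and "continuous_on (X \<times> Y) c"
  shows "K_cost c (plan_measure X Y D) =
    (\<Sum>i\<in>idx (src D). \<Sum>j\<in>idx (tgt D). wt D i j * c (tag (src D) i, tag (tgt D) j))"
proof -
  let ?A = "idx (src D) \<times> idx (tgt D)"
  have fin: "finite ?A"
    and pts: "\<And>i. i \<in> idx (src D) \<Longrightarrow> tag (src D) i \<in> X" "\<And>j. j \<in> idx (tgt D) \<Longrightarrow> tag (tgt D) j \<in> Y"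
    and nn: "\<And>z. z \<in> ?A \<Longrightarrow> 0 \<le> (case z of (i, j) \<Rightarrow> wt D i j)"
    using assms(1) unfolding h_plan_def h_partition_def by auto
  have c: "c \<in> borel_measurable (restrict_space borel (X \<times> Y))"
    using assms(2) by (rule borel_measurable_continuous_on_restrict)
  have m: "(\<lambda>(i, j). (tag (src D) i, tag (tgt D) j)) \<in>
      measurable (point_measure ?A (\<lambda>(i, j). ennreal (wt D i j))) (restrict_space borel (X \<times> Y))"
    using pts by (auto simp: measurable_def space_point_measure sets_point_measure space_restrict_space)
  have "K_cost c (plan_measure X Y D) =
      (LINT z|point_measure ?A (\<lambda>z. ennreal (case z of (i, j) \<Rightarrow> wt D i j)).
        c (case z of (i, j) \<Rightarrow> (tag (src D) i, tag (tgt D) j)))"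
    unfolding K_cost_def plan_measure_def by (subst integral_distr[OF m c]) (simp add: case_prod_unfold)
  also have "\<dots> = (\<Sum>z\<in>?A. (case z of (i, j) \<Rightarrow> wt D i j) * c (case z of (i, j) \<Rightarrow> (tag (src D) i, tag (tgt D) j)))"
    using fin nn by (subst lebesgue_integral_point_measure_finite) auto
  finally show ?thesis
    by (simp add: sum.cartesian_product case_prod_unfold)
qed

definition eps_optimal ::
    "'a::metric_space set \<Rightarrow> 'b::metric_space set \<Rightarrow> 'a measure \<Rightarrow> 'b measure \<Rightarrow> ('a \<times> 'b \<Rightarrow> real)
      \<Rightarrow> real \<Rightarrow> ('a, 'b) discrete_plan \<Rightarrow> bool"
  where "eps_optimal X Y \<mu> \<nu> c \<epsilon> D \<longleftrightarrow>
    0 \<le> \<epsilon> \<and> h_plan X Y \<mu> \<nu> D \<and>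
    (\<forall>w. h_plan X Y \<mu> \<nu> (D\<lparr>wt := w\<rparr>) \<longrightarrow>
      K_cost c (plan_measure X Y D) \<le> \<epsilon> + K_cost c (plan_measure X Y (D\<lparr>wt := w\<rparr>)))"

definition approx_plan_seq ::
    "'a::metric_space set \<Rightarrow> 'b::metric_space set \<Rightarrow> 'a measure \<Rightarrow> 'b measure \<Rightarrow> ('a \<times> 'b \<Rightarrow> real)
      \<Rightarrow> (nat \<Rightarrow> ('a, 'b) discrete_plan) \<Rightarrow> bool"
  where "approx_plan_seq X Y \<mu> \<nu> c D \<longleftrightarrow>
    (\<lambda>k. mesh (D k)) \<longlonglongrightarrow> 0 \<and>
    (\<exists>\<epsilon>. \<epsilon> \<longlonglongrightarrow> 0 \<and> (\<forall>k. eps_optimal X Y \<mu> \<nu> c (\<epsilon> k) (D k)))"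

definition approx_geometric_median ::
    "'b::metric_space set \<Rightarrow> real \<Rightarrow> nat set \<Rightarrow> (nat \<Rightarrow> 'b) \<Rightarrow> (nat \<Rightarrow> real) \<Rightarrow> 'b \<Rightarrow> bool"
  where "approx_geometric_median Y \<epsilon> J y w m \<longleftrightarrow>
    m \<in> Y \<and> (\<forall>z\<in>Y. (\<Sum>j\<in>J. w j * dist m (y j)) \<le> (\<Sum>j\<in>J. w j * dist z (y j)) + \<epsilon>)"

text \<open>
  A normed structure on \<open>Y\<close> is an identification \<open>\<iota>\<close> of \<open>Y\<close> with a convex subset of a normed vector
  space, carrying the metric of \<open>Y\<close> to the norm metric; barycenters are formed through \<open>\<iota>\<close>. When the
  type of \<open>Y\<close> is itself a normed vector space and \<open>Y\<close> is convex, \<open>\<iota>\<close> can be taken to be the identity.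
\<close>

definition normed_via :: "('b::metric_space \<Rightarrow> 'v::real_normed_vector) \<Rightarrow> 'b set \<Rightarrow> bool"
  where "normed_via \<iota> Y \<longleftrightarrow>
    convex (\<iota> ` Y) \<and> (\<forall>y\<in>Y. \<forall>z\<in>Y. dist y z = norm (\<iota> y - \<iota> z))"

definition cellwise_constant ::
    "'a::metric_space set \<Rightarrow> 'b::metric_space set \<Rightarrow> 'a tagged_partition \<Rightarrow> ('a \<Rightarrow> 'b) \<Rightarrow> bool"
  where "cellwise_constant X Y P T \<longleftrightarrow>
    T \<in> measurable (restrict_space borel X) (restrict_space borel Y) \<and>
    (\<forall>i\<in>idx P. \<forall>x\<in>cell P i. T x = T (tag P i))"

definition GM_maps ::
    "'a::metric_space set \<Rightarrow> 'b::metric_space set \<Rightarrow> 'a measure \<Rightarrow> real \<Rightarrow> ('a, 'b) discrete_plan \<Rightarrow> ('a \<Rightarrow> 'b) set"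
  where "GM_maps X Y \<mu> Q D =
    {T. cellwise_constant X Y (src D) T \<and>
        (\<forall>i\<in>idx (src D). 0 < measure \<mu> (cell (src D) i) \<longrightarrow>
          approx_geometric_median Y (Q * mesh D) (idx (tgt D)) (tag (tgt D))
            (\<lambda>j. wt D i j / measure \<mu> (cell (src D) i)) (T (tag (src D) i)))}"

definition B_maps ::
    "'a::metric_space set \<Rightarrow> 'b::metric_space set \<Rightarrow> ('b \<Rightarrow> 'v::real_normed_vector) \<Rightarrow> 'a measure
      \<Rightarrow> ('a, 'b) discrete_plan \<Rightarrow> ('a \<Rightarrow> 'b) set"
  where "B_maps X Y \<iota> \<mu> D =
    (if normed_via \<iota> Y then
      {T. cellwise_constant X Y (src D) T \<and>
          (\<forall>i\<in>idx (src D). 0 < measure \<mu> (cell (src D) i) \<longrightarrow>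
            \<iota> (T (tag (src D) i)) =
              (\<Sum>j\<in>idx (tgt D). (wt D i j / measure \<mu> (cell (src D) i)) *\<^sub>R \<iota> (tag (tgt D) j)))}
     else {})"

definition projection_maps ::
    "'a::metric_space set \<Rightarrow> 'b::metric_space set \<Rightarrow> ('b \<Rightarrow> 'v::real_normed_vector) \<Rightarrow> 'a measure
      \<Rightarrow> real \<Rightarrow> ('a, 'b) discrete_plan \<Rightarrow> ('a \<Rightarrow> 'b) set"
  where "projection_maps X Y \<iota> \<mu> Q D = GM_maps X Y \<mu> Q D \<union> B_maps X Y \<iota> \<mu> D"

text \<open>The plans \<open>D k\<close> underlying the maps \<open>T k\<close> stay visible, since \<open>disc\<close> below depends on their partitions.\<close>

definition approx_map_seq ::
    "'a::metric_space set \<Rightarrow> 'b::metric_space set \<Rightarrow> ('b \<Rightarrow> 'v::real_normed_vector) \<Rightarrow> 'a measure \<Rightarrow> 'b measure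
      \<Rightarrow> ('a \<times> 'b \<Rightarrow> real) \<Rightarrow> (nat \<Rightarrow> ('a, 'b) discrete_plan) \<Rightarrow> (nat \<Rightarrow> 'a \<Rightarrow> 'b) \<Rightarrow> bool"
  where "approx_map_seq X Y \<iota> \<mu> \<nu> c D T \<longleftrightarrow>
    approx_plan_seq X Y \<mu> \<nu> c D \<and> (\<exists>Q\<ge>0. \<forall>k. T k \<in> projection_maps X Y \<iota> \<mu> Q (D k))"

definition disc ::
    "real \<Rightarrow> 'a measure \<Rightarrow> 'a tagged_partition \<Rightarrow> ('a \<Rightarrow> 'b::metric_space) \<Rightarrow> ('a \<Rightarrow> 'b) \<Rightarrow> real"
  where "disc p \<mu> P S T =
    (\<Sum>i\<in>idx P. measure \<mu> (cell P i) * dist (S (tag P i)) (T (tag P i)) powr p) powr (1 / p)"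

end

theory Submission
  imports Defs
begin

text \<open>
  \<^bold>\<open>From (i) to (ii).\<close> An \<open>h\<close>-plan and a transport plan are matched if they give the same mass to all cells. Every
  \<open>h\<close>-plan is matched to some transport plan and vice versa, and matched plans have nearly the same cost, so
  an approximating sequence of discrete plans is matched to a minimizing sequence \<open>\<pi>\<^sub>k\<close> of transport plans.
  Such a sequence clusters at the unique optimal plan, which is carried by the graph of \<open>T\<close>, hence the
  integrals of \<open>d(y, T x)\<close> under \<open>\<pi>\<^sub>k\<close> tend to 0, with no continuity of \<open>T\<close> needed. Passing from \<open>T x\<close> to the value
  of \<open>T\<close> at the tag of the cell of \<open>x\<close> costs an integral that vanishes by dominated convergence if \<open>T\<close>
  is continuous almost everywhere. A median or barycenter is at most about twice as far from a point as the target tags are on average.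

  The cluster point is found without weak convergence. Since the marginals are fixed, values on rectangles suffice:
  they form points of a cube, which is compact by Tychonoff, and every biadditive nonnegative function on
  rectangles with marginals \<open>\<mu>\<close> and \<open>\<nu>\<close> extends to a transport plan.

  \<^bold>\<open>From (ii) to (i).\<close> The discretizations of the optimal plan are almost optimal whatever the tags are, and the
  projection maps do not depend on the tags in \<open>X\<close>. Two choices of tags then show that the
  oscillation of \<open>T\<close> over the cells tends to 0 in mean, and the cells can be chosen so that almost every
  point is interior to its cell.
\<close>

subsection \<open>Regularity and partitions\<close>

lemma sets_restrict_borel_compact:
  fixes X :: "'a::metric_space set"
  assumes "compact X"
  shows "A \<in> sets (restrict_space borel X) \<longleftrightarrow> A \<in> sets borel \<and> A \<subseteq> X"
  using assms by (subst sets_restrict_space_iff) (auto intro: borel_closed compact_imp_closed)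

text \<open>The types are not assumed second countable, so the Borel sets of the product need not be
  generated by rectangles. This inclusion survives: a rectangle is an intersection of preimages
  under the continuous projections.\<close>

lemma Times_in_sets_borel:
  fixes A :: "'a::metric_space set" and B :: "'b::metric_space set"
  assumes "A \<in> sets borel" "B \<in> sets borel"
  shows "A \<times> B \<in> sets borel"
proof -
  have 1: "(fst :: 'a \<times> 'b \<Rightarrow> 'a) \<in> borel_measurable borel"
    by (intro borel_measurable_continuous_onI continuous_on_fst continuous_on_id)
  have 2: "(snd :: 'a \<times> 'b \<Rightarrow> 'b) \<in> borel_measurable borel"
    by (intro borel_measurable_continuous_onI continuous_on_snd continuous_on_id)
  have "A \<times> B = (fst -` A \<inter> space borel) \<inter> (snd -` B \<inter> space borel)" by auto
  also have "\<dots> \<in> sets borel"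
    by (intro sets.Int measurable_sets[OF 1] measurable_sets[OF 2] assms)
  finally show ?thesis .
qed

text \<open>The sets that admit such approximations for every \<open>e\<close> include the closed
  sets and are stable under complements and countable unions, so they exhaust the Borel
  sets.\<close>

lemma regular_compact:
  fixes X :: "'a::metric_space set"
  assumes X: "compact X" and "finite_measure M" and sM: "sets M = sets (restrict_space borel X)"
    and A: "A \<in> sets M" and "0 < e"
  obtains K U where "closed K" "open U" "K \<subseteq> A" "A \<subseteq> U" "measure M (U \<inter> X - K) < e"
proof -
  interpret M: finite_measure M by fact
  have inM: "S \<in> sets M \<longleftrightarrow> S \<in> sets borel \<and> S \<subseteq> X" for S
    unfolding sM by (rule sets_restrict_borel_compact[OF X])
  have Xcl: "closed X" using X by (rule compact_imp_closed)
  have Xb: "X \<in> sets borel" using Xcl by (rule borel_closed)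
  have good: "\<forall>e>0. \<exists>K U. closed K \<and> open U \<and> K \<subseteq> X \<inter> B \<and> X \<inter> B \<subseteq> U \<and> measure M (U \<inter> X - K) < e"
    if "B \<in> sigma_sets UNIV {S. closed S}" for B :: "'a set"
    using that
  proof induction
    case (Basic C)
    then have C: "closed C" by simp
    show ?case
    proof (intro allI impI)
      fix e :: real assume "0 < e"
      \<comment> \<open>These open neighbourhoods decrease to the closed set
        \<open>X \<inter> C\<close>, so their excess mass tends to 0.\<close>
      define U where "U n = (\<Union>x\<in>X \<inter> C. ball x (inverse (Suc n)))" for n
      have oU: "open (U n)" for n unfolding U_def by auto
      have sub: "X \<inter> C \<subseteq> U n" for n unfolding U_def by force
      have "(\<lambda>n. measure M (U n \<inter> X - X \<inter> C)) \<longlonglongrightarrow> measure M (\<Inter>n. U n \<inter> X - X \<inter> C)"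
      proof (rule M.finite_Lim_measure_decseq)
        show "range (\<lambda>n. U n \<inter> X - X \<inter> C) \<subseteq> sets M"
          using oU C Xb by (auto simp: inM borel_open borel_closed)
        have "U n \<subseteq> U m" if "m \<le> n" for m n
          using that unfolding U_def by (intro UN_mono subset_ball) auto
        then show "decseq (\<lambda>n. U n \<inter> X - X \<inter> C)" unfolding decseq_def by blast
      qed
      moreover have "(\<Inter>n. U n \<inter> X - X \<inter> C) = {}"
      proof (rule ccontr)
        assume "(\<Inter>n. U n \<inter> X - X \<inter> C) \<noteq> {}"
        then obtain x where x: "\<And>n. x \<in> U n" "x \<notin> X \<inter> C" by auto
        have "x \<in> closure (X \<inter> C)" unfolding closure_approachable
        proof (intro allI impI)
          fix d :: real assume "0 < d"
          then obtain n where "inverse (Suc n) < d" using reals_Archimedean by blast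
          then show "\<exists>y\<in>X \<inter> C. dist y x < d" using x(1)[of n] unfolding U_def by (force simp: dist_commute)
        qed
        with x(2) C Xcl show False by (auto simp: closure_closed closed_Int)
      qed
      ultimately have "(\<lambda>n. measure M (U n \<inter> X - X \<inter> C)) \<longlonglongrightarrow> 0" by (simp only: measure_empty)
      then have "\<forall>\<^sub>F n in sequentially. measure M (U n \<inter> X - X \<inter> C) < e"
        using \<open>0 < e\<close> by (rule order_tendstoD)
      then obtain n where "measure M (U n \<inter> X - X \<inter> C) < e" by (auto simp: eventually_sequentially)
      then show "\<exists>K U. closed K \<and> open U \<and> K \<subseteq> X \<inter> C \<and> X \<inter> C \<subseteq> U \<and> measure M (U \<inter> X - K) < e"
        using C Xcl oU sub by (intro exI[of _ "X \<inter> C"] exI[of _ "U n"]) (auto simp: closed_Int)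
    qed
  next
    case Empty
    show ?case by (intro allI impI exI[of _ "{}"]) auto
  next
    case (Compl B)
    show ?case
    proof (intro allI impI)
      fix e :: real assume "0 < e"
      obtain K U where KU: "closed K" "open U" "K \<subseteq> X \<inter> B" "X \<inter> B \<subseteq> U" "measure M (U \<inter> X - K) < e"
        using Compl.IH[rule_format, OF \<open>0 < e\<close>] by metis
      \<comment> \<open>Complementation exchanges the roles: the closed \<open>X - U\<close> becomes
        the inner set and the open \<open>- K\<close> the outer one, with the same gap.\<close>
      have eq: "- K \<inter> X - (X - U) = U \<inter> X - K" by auto
      have "closed (X - U)" "open (- K)" using KU Xcl by (auto simp: closed_Diff)
      moreover have "X - U \<subseteq> X \<inter> (UNIV - B)" "X \<inter> (UNIV - B) \<subseteq> - K" using KU(3,4) by blast+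
      ultimately show "\<exists>K U. closed K \<and> open U \<and> K \<subseteq> X \<inter> (UNIV - B) \<and> X \<inter> (UNIV - B) \<subseteq> U \<and> measure M (U \<inter> X - K) < e"
        using KU(5) unfolding eq[symmetric] by blast
    qed
  next
    case (Union B)
    show ?case
    proof (intro allI impI)
      fix e :: real assume e: "0 < e"
      \<comment> \<open>The individual errors add up to at most \<open>e / 2\<close>. The union of
        all \<open>K n\<close> need not be closed; the rest of \<open>e\<close> pays for replacing
        it by a finite union.\<close>
      define d where "d n = e / 2 * (1/2) ^ Suc n" for n :: nat
      have d: "0 < d n" for n unfolding d_def using e by simp
      have "\<forall>n. \<exists>K U. closed K \<and> open U \<and> K \<subseteq> X \<inter> B n \<and> X \<inter> B n \<subseteq> U \<and> measure M (U \<inter> X - K) < d n"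
        using Union.IH d by blast
      then obtain K U where KU: "\<And>n. closed (K n)" "\<And>n. open (U n)" "\<And>n. K n \<subseteq> X \<inter> B n"
        "\<And>n. X \<inter> B n \<subseteq> U n" "\<And>n. measure M (U n \<inter> X - K n) < d n" by metis
      have mK: "K n \<in> sets M" "U n \<inter> X \<in> sets M" for n
        using KU(1,2,3)[of n] Xb by (auto simp: inM borel_open borel_closed)
      have dsum: "d sums (e / 2)"
        unfolding d_def using sums_mult[OF power_half_series, of "e/2"] by simp
      have sm: "summable (\<lambda>n. measure M (U n \<inter> X - K n))"
        by (rule summable_comparison_test_ev[OF _ sums_summable[OF dsum]])
          (use KU(5) in \<open>auto intro!: always_eventually less_imp_le\<close>)
      have "measure M (\<Union>n. (U n \<inter> X - K n)) \<le> (\<Sum>n. measure M (U n \<inter> X - K n))"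
        using mK sm by (intro M.finite_measure_subadditive_countably) auto
      also have "\<dots> \<le> e / 2"
        unfolding sums_unique[OF dsum] using sm sums_summable[OF dsum] KU(5)
        by (intro suminf_le) (auto intro: less_imp_le)
      finally have 1: "measure M (\<Union>n. (U n \<inter> X - K n)) \<le> e / 2" .
      have 2: "(\<Inter>n. (\<Union>n. U n) \<inter> X - (\<Union>i<n. K i)) \<subseteq> (\<Union>n. (U n \<inter> X - K n))"
        by blast
      have "measure M (\<Inter>n. (\<Union>n. U n) \<inter> X - (\<Union>i<n. K i)) \<le> e / 2"
        using mK by (intro order_trans[OF M.finite_measure_mono[OF 2] 1]) auto
      moreover have "(\<lambda>n. measure M ((\<Union>n. U n) \<inter> X - (\<Union>i<n. K i)))
          \<longlonglongrightarrow> measure M (\<Inter>n. (\<Union>n. U n) \<inter> X - (\<Union>i<n. K i))"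
      proof (rule M.finite_Lim_measure_decseq)
        have "(\<Union>n. U n) \<inter> X \<in> sets M" using mK(2) by (metis UN_extend_simps(4) sets.countable_UN'' countableI_type)
        then show "range (\<lambda>n. (\<Union>n. U n) \<inter> X - (\<Union>i<n. K i)) \<subseteq> sets M"
          using mK(1) by auto
        show "decseq (\<lambda>n. (\<Union>n. U n) \<inter> X - (\<Union>i<n. K i))"
          unfolding decseq_def by (auto dest: order_less_le_trans)
      qed
      ultimately have "\<forall>\<^sub>F n in sequentially. measure M ((\<Union>n. U n) \<inter> X - (\<Union>i<n. K i)) < e"
        using e by (elim order_tendstoD(2)) linarith
      then obtain n where "measure M ((\<Union>n. U n) \<inter> X - (\<Union>i<n. K i)) < e"
        by (auto simp: eventually_sequentially)
      moreover have "closed (\<Union>i<n. K i)" "open (\<Union>n. U n)" using KU(1,2) by (auto intro!: closed_UN)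
      moreover have "(\<Union>i<n. K i) \<subseteq> X \<inter> (\<Union>i. B i)" "X \<inter> (\<Union>i. B i) \<subseteq> (\<Union>n. U n)"
        using KU(3,4) by blast+
      ultimately show "\<exists>K U. closed K \<and> open U \<and> K \<subseteq> X \<inter> (\<Union>i. B i) \<and> X \<inter> (\<Union>i. B i) \<subseteq> U \<and> measure M (U \<inter> X - K) < e"
        by blast
    qed
  qed
  have "A \<in> sigma_sets UNIV {S. closed S}" "A \<subseteq> X"
    using A inM by (auto simp: borel_eq_closed)
  moreover from this have "X \<inter> A = A" by auto
  ultimately show ?thesis using good[of A] \<open>0 < e\<close> that by metis
qed

lemma diameter_leI:
  fixes S :: "'a::metric_space set"
  assumes "\<And>x y. x \<in> S \<Longrightarrow> y \<in> S \<Longrightarrow> dist x y \<le> d" "0 \<le> d"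
  shows "diameter S \<le> d"
  using assms unfolding diameter_def by (auto intro!: cSUP_least)

text \<open>The image of the measure under \<open>f\<close> has at most countably many atoms,
  whereas an interval is uncountable.\<close>

lemma exists_null_radius:
  fixes f :: "'a \<Rightarrow> real"
  assumes M: "finite_measure M" and [measurable]: "f \<in> borel_measurable M" and "a < b"
  obtains r where "a < r" "r < b" "measure M {x \<in> space M. f x = r} = 0"
proof -
  interpret D: finite_measure "distr M borel f"
    by (rule finite_measure.finite_measure_distr[OF M]) simp
  have "\<not> {a<..<b} \<subseteq> {r. measure (distr M borel f) {r} \<noteq> 0}"
    using countable_subset[OF _ D.countable_support, of "{a<..<b}"] uncountable_open_interval[of a b]
      \<open>a < b\<close> by metis
  then obtain r where "a < r" "r < b" "measure (distr M borel f) {r} = 0" by auto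
  moreover have "measure (distr M borel f) {r} = measure M {x \<in> space M. f x = r}"
    by (subst measure_distr) (simp_all add: vimage_def Int_def conj_commute)
  ultimately show ?thesis using that by auto
qed

text \<open>Almost every point is interior to its cell because the radii of the balls are chosen so that
  their boundary spheres are null sets.\<close>

lemma exists_h_partition:
  fixes X :: "'a::metric_space set"
  assumes X: "compact X" and M: "finite_measure M" and sM: "sets M = sets (restrict_space borel X)"
    and "0 < h"
  obtains P N where "h_partition X h P" "N \<in> null_sets M"
    "\<And>x. x \<in> X - N \<Longrightarrow> \<exists>i\<in>idx P. \<exists>U. open U \<and> x \<in> U \<and> U \<inter> X \<subseteq> cell P i"
proof -
  interpret M: finite_measure M by fact
  have spM: "space M = X" using sets_eq_imp_space_eq[OF sM] by (simp add: space_restrict_space)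
  have inM: "S \<in> sets M \<longleftrightarrow> S \<in> sets borel \<and> S \<subseteq> X" for S
    unfolding sM by (rule sets_restrict_borel_compact[OF X])
  have Xb: "X \<in> sets borel" using X by (intro borel_closed compact_imp_closed)
  have "(\<lambda>x. dist a x) \<in> borel_measurable borel" for a :: 'a
    by (intro borel_measurable_continuous_onI continuous_intros)
  then have dm: "(\<lambda>x. dist a x) \<in> borel_measurable M" for a :: 'a
    by (subst measurable_cong_sets[OF sM refl]) (rule measurable_restrict_space1)
  \<comment> \<open>The upper bound keeps the diameter of a ball at most \<open>h\<close>; the lower
    one keeps the radius positive, so that the balls cover \<open>X\<close>.\<close>
  have "\<exists>r. h/4 < r \<and> r < h/2 \<and> measure M {x \<in> space M. dist a x = r} = 0" for a
    using exists_null_radius[OF M dm[of a], of "h/4" "h/2"] \<open>0 < h\<close> by auto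
  then obtain r where r: "\<And>a. h/4 < r a" "\<And>a. r a < h/2" "\<And>a. measure M {x \<in> X. dist a x = r a} = 0"
    unfolding spM by metis
  have "X \<subseteq> (\<Union>a\<in>X. ball a (r a))"
    using r(1) \<open>0 < h\<close> by (force intro: less_trans[of 0 "h/4"])
  then obtain F where F: "F \<subseteq> X" "finite F" "X \<subseteq> (\<Union>a\<in>F. ball a (r a))"
    using compactE_image[OF X, of X "\<lambda>a. ball a (r a)"] by (metis open_ball)
  obtain n and f :: "nat \<Rightarrow> 'a" where f: "F = f ` {i. i < n}"
    using finite_imp_nat_seg_image_inj_on[OF F(2)] by metis
  define B where "B i = ball (f i) (r (f i)) \<inter> X" for i
  \<comment> \<open>Subtracting the earlier balls makes the cells disjoint. Empty ones are dropped,
    because each cell has to contain its tag.\<close>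
  define P where "P = \<lparr>idx = {i. i < n \<and> disjointed B i \<noteq> {}}, cell = disjointed B,
    tag = (\<lambda>i. SOME x. x \<in> disjointed B i)\<rparr>"
  define N where "N = (\<Union>i<n. {x \<in> X. dist (f i) x = r (f i)})"
  have Bm: "B i \<in> sets M" for i unfolding B_def inM using Xb by (auto intro: borel_open)
  have Em: "disjointed B i \<in> sets M" for i
    using Bm sets.range_disjointed_sets[of B M] by auto
  have cover: "x \<in> disjointed B i \<and> i < n \<and> (\<forall>j<i. x \<notin> B j)"
    if x: "x \<in> X" and i: "i = (LEAST i. x \<in> B i)" for x i
  proof -
    obtain a where "a \<in> F" "x \<in> ball a (r a)" using x F(3) by blast
    then obtain j where j: "j < n" "x \<in> B j" using x by (auto simp: f B_def)
    have "x \<in> B i" using j(2) unfolding i by (rule LeastI)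
    moreover have "i \<le> j" using j(2) unfolding i by (rule Least_le)
    moreover have "\<forall>j<i. x \<notin> B j" unfolding i using not_less_Least by auto
    ultimately show ?thesis using j(1) by (auto simp: disjointed_def)
  qed
  show ?thesis
  proof
    show "h_partition X h P" unfolding h_partition_def
    proof (intro conjI ballI)
      show "0 \<le> h" "finite (idx P)" using \<open>0 < h\<close> by (auto simp: P_def)
      show "disjoint_family_on (cell P) (idx P)"
        using disjoint_family_disjointed[of B] by (auto simp: P_def disjoint_family_on_def)
      show "(\<Union>i\<in>idx P. cell P i) = X"
      proof (intro equalityI subsetI)
        fix x assume "x \<in> X"
        from cover[OF this refl] show "x \<in> (\<Union>i\<in>idx P. cell P i)" by (auto simp: P_def)
      next
        fix x assume "x \<in> (\<Union>i\<in>idx P. cell P i)"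
        then obtain i where "x \<in> disjointed B i" by (auto simp: P_def)
        then show "x \<in> X" using disjointed_subset[of B i] by (auto simp: B_def)
      qed
    next
      fix i assume i: "i \<in> idx P"
      show "cell P i \<in> sets (restrict_space borel X)" using Em by (simp add: P_def sM)
      show "tag P i \<in> cell P i" using i by (auto simp: P_def some_in_eq)
      show "diameter (cell P i) \<le> h"
      proof (rule diameter_leI)
        fix x y assume "x \<in> cell P i" "y \<in> cell P i"
        then have "x \<in> B i" "y \<in> B i" using disjointed_subset[of B i] by (auto simp: P_def)
        then have "dist (f i) x < r (f i)" "dist (f i) y < r (f i)" by (auto simp: B_def)
        then show "dist x y \<le> h"
          using r(2)[of "f i"] dist_triangle[of x y "f i"] by (simp add: dist_commute)
      qed (use \<open>0 < h\<close> in simp)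
    qed
    have "closed {x. dist (f i) x = r (f i)}" for i
      by (intro closed_Collect_eq continuous_intros)
    then have "{x. dist (f i) x = r (f i)} \<inter> X \<in> sets borel" for i using Xb by (auto intro: borel_closed)
    moreover have "{x \<in> X. dist (f i) x = r (f i)} = {x. dist (f i) x = r (f i)} \<inter> X" for i by auto
    ultimately have "{x \<in> X. dist (f i) x = r (f i)} \<in> sets M" for i
      unfolding inM by auto
    then have "{x \<in> X. dist (f i) x = r (f i)} \<in> null_sets M" for i
      using r(3) by (intro null_setsI) (auto simp: M.emeasure_eq_measure)
    then show "N \<in> null_sets M" unfolding N_def by (intro null_sets_UN') auto
    fix x assume x: "x \<in> X - N"
    define i where "i = (LEAST i. x \<in> B i)"
    have i: "x \<in> disjointed B i" "i < n" "\<And>j. j < i \<Longrightarrow> x \<notin> B j"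
      using cover[OF _ i_def] x by auto
    \<comment> \<open>Off the spheres, a point that misses the earlier open balls misses the closed
      ones as well, so removing the closed balls leaves an open neighbourhood of it.\<close>
    define U where "U = ball (f i) (r (f i)) \<inter> (\<Inter>j<i. - cball (f j) (r (f j)))"
    have "open U" unfolding U_def by (intro open_Int open_INT) auto
    moreover have "x \<in> U"
    proof -
      have "dist (f j) x > r (f j)" if "j < i" for j
      proof -
        have "dist (f j) x \<noteq> r (f j)" using x that i(2) by (auto simp: N_def)
        with i(3)[OF that] x show ?thesis by (auto simp: B_def)
      qed
      moreover have "x \<in> B i" using i(1) disjointed_subset[of B i] by blast
      ultimately show ?thesis by (simp add: U_def B_def not_le)
    qed
    moreover have "U \<inter> X \<subseteq> disjointed B i"
      unfolding U_def disjointed_def B_def by force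
    ultimately show "\<exists>i\<in>idx P. \<exists>U. open U \<and> x \<in> U \<and> U \<inter> X \<subseteq> cell P i"
      using i by (intro bexI[of _ i]) (auto simp: P_def)
  qed
qed

text \<open>The diameter controls distances only in a bounded set; compactness of \<open>Z\<close>
  provides boundedness.\<close>

lemma h_partition_dist_le:
  assumes "compact Z" "h_partition Z h P" "i \<in> idx P" "x \<in> cell P i" "y \<in> cell P i"
  shows "dist x y \<le> h"
proof -
  have "cell P i \<subseteq> Z" using assms by (auto simp: h_partition_def)
  then have "bounded (cell P i)" using assms(1) bounded_subset compact_imp_bounded by blast
  then have "dist x y \<le> diameter (cell P i)" using assms by (intro diameter_bounded_bound)
  then show ?thesis using assms by (force simp: h_partition_def)
qed

subsection \<open>Extending set functions on rectangles\<close>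

text \<open>Measurable rectangles are Borel. Conversely, total boundedness makes every relatively
  open set a countable union of rectangles formed by the cells of ever finer partitions.\<close>

lemma sets_pair_restrict_borel:
  fixes X :: "'a::metric_space set" and Y :: "'b::metric_space set"
  assumes X: "compact X" and Y: "compact Y"
  shows "sets (restrict_space borel X \<Otimes>\<^sub>M restrict_space borel Y) = sets (restrict_space borel (X \<times> Y))"
    (is "sets (?MX \<Otimes>\<^sub>M ?MY) = sets ?MXY")
proof
  have XY: "compact (X \<times> Y)" using X Y by (rule compact_Times)
  have sp: "space ?MX = X" "space ?MY = Y" by (auto simp: space_restrict_space)
  have "A \<times> B \<in> sets ?MXY" if "A \<in> sets ?MX" "B \<in> sets ?MY" for A B
    using that unfolding sets_restrict_borel_compact[OF X] sets_restrict_borel_compact[OF Y]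
      sets_restrict_borel_compact[OF XY] by (auto intro: Times_in_sets_borel)
  moreover have "X \<times> Y \<in> sets ?MXY" using sets.top[of ?MXY] by (simp add: space_restrict_space)
  ultimately show "sets (?MX \<Otimes>\<^sub>M ?MY) \<subseteq> sets ?MXY"
    unfolding sets_pair_measure sp by (intro sets.sigma_sets_subset') auto
  have op: "U \<inter> (X \<times> Y) \<in> sets (?MX \<Otimes>\<^sub>M ?MY)" if U: "open U" for U :: "('a \<times> 'b) set"
  proof -
    \<comment> \<open>Only the partition is wanted here; the zero measure fills the measure
      argument.\<close>
    have "\<exists>P. h_partition X (inverse (Suc n)) P" for n
      by (rule exists_h_partition[OF X, of "null_measure ?MX" "inverse (Suc n)"])
        (auto intro!: finite_measureI)
    then obtain P where P: "\<And>n. h_partition X (inverse (Suc n)) (P n)" by metis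
    have "\<exists>P. h_partition Y (inverse (Suc n)) P" for n
      by (rule exists_h_partition[OF Y, of "null_measure ?MY" "inverse (Suc n)"])
        (auto intro!: finite_measureI)
    then obtain R where R: "\<And>n. h_partition Y (inverse (Suc n)) (R n)" by metis
    define J where "J n = {(i, j). i \<in> idx (P n) \<and> j \<in> idx (R n) \<and> cell (P n) i \<times> cell (R n) j \<subseteq> U}" for n
    have fin: "finite (J n)" for n
      by (rule finite_subset[of _ "idx (P n) \<times> idx (R n)"])
        (use P[of n] R[of n] in \<open>auto simp: J_def h_partition_def\<close>)
    have "U \<inter> (X \<times> Y) = (\<Union>n. \<Union>(i, j)\<in>J n. cell (P n) i \<times> cell (R n) j)"
    proof (intro equalityI subsetI)
      fix z assume z: "z \<in> U \<inter> (X \<times> Y)"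
      then obtain e where e: "0 < e" "ball z e \<subseteq> U" using U by (metis IntD1 open_contains_ball)
      obtain n where n: "inverse (Suc n) < e / 2" using reals_Archimedean[of "e/2"] e by auto
      obtain x y where xy: "z = (x, y)" "x \<in> X" "y \<in> Y" using z by auto
      obtain i where i: "i \<in> idx (P n)" "x \<in> cell (P n) i"
        using P[of n] xy(2) by (auto simp: h_partition_def)
      obtain j where j: "j \<in> idx (R n)" "y \<in> cell (R n) j"
        using R[of n] xy(3) by (auto simp: h_partition_def)
      have "cell (P n) i \<times> cell (R n) j \<subseteq> U"
      proof (clarify, rule subsetD[OF e(2)])
        fix a b assume ab: "a \<in> cell (P n) i" "b \<in> cell (R n) j"
        have "dist x a \<le> inverse (Suc n)" "dist y b \<le> inverse (Suc n)"
          using h_partition_dist_le[OF X P i ab(1)] h_partition_dist_le[OF Y R j ab(2)] .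
        moreover have "dist z (a, b) \<le> dist x a + dist y b"
          unfolding xy dist_Pair_Pair by (rule sqrt_sum_squares_le_sum) auto
        ultimately show "(a, b) \<in> ball z e" using n by simp
      qed
      then show "z \<in> (\<Union>n. \<Union>(i, j)\<in>J n. cell (P n) i \<times> cell (R n) j)"
        using i j xy by (auto simp: J_def)
    next
      fix z assume "z \<in> (\<Union>n. \<Union>(i, j)\<in>J n. cell (P n) i \<times> cell (R n) j)"
      then obtain n i j where "i \<in> idx (P n)" "j \<in> idx (R n)" "cell (P n) i \<times> cell (R n) j \<subseteq> U"
        "z \<in> cell (P n) i \<times> cell (R n) j" by (auto simp: J_def)
      then show "z \<in> U \<inter> (X \<times> Y)" using P[of n] R[of n] by (fastforce simp: h_partition_def)
    qed
    also have "\<dots> \<in> sets (?MX \<Otimes>\<^sub>M ?MY)"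
    proof (intro sets.countable_UN'' sets.finite_UN fin)
      fix n z assume "z \<in> J n"
      then show "(case z of (i, j) \<Rightarrow> cell (P n) i \<times> cell (R n) j) \<in> sets (?MX \<Otimes>\<^sub>M ?MY)"
        using P[of n] R[of n] by (auto simp: J_def h_partition_def intro!: pair_measureI)
    qed auto
    finally show ?thesis .
  qed
  have "(\<lambda>z. z) \<in> measurable (?MX \<Otimes>\<^sub>M ?MY) (borel :: ('a \<times> 'b) measure)"
  proof (rule borel_measurableI)
    fix U :: "('a \<times> 'b) set" assume "open U"
    then show "(\<lambda>z. z) -` U \<inter> space (?MX \<Otimes>\<^sub>M ?MY) \<in> sets (?MX \<Otimes>\<^sub>M ?MY)"
      using op[of U] by (simp add: space_pair_measure sp)
  qed
  then have "(\<lambda>z. z) -` W \<inter> space (?MX \<Otimes>\<^sub>M ?MY) \<in> sets (?MX \<Otimes>\<^sub>M ?MY)" if "W \<in> sets borel"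
    for W :: "('a \<times> 'b) set" using that by (rule measurable_sets)
  then show "sets ?MXY \<subseteq> sets (?MX \<Otimes>\<^sub>M ?MY)"
    unfolding sets_restrict_space by (auto simp: space_pair_measure sp Int_commute)
qed

section \<open>Finitely additive functions on rectangles\<close>

text \<open>A bimeasure without countable additivity. These are the properties that a pointwise
  limit of transport plans on rectangles keeps for simple reasons.\<close>

locale biadditive =
  fixes M :: "'a measure" and N :: "'b measure" and p :: "'a set \<Rightarrow> 'b set \<Rightarrow> real"
  assumes nonneg: "A \<in> sets M \<Longrightarrow> B \<in> sets N \<Longrightarrow> 0 \<le> p A B"
    and add1: "A \<in> sets M \<Longrightarrow> A' \<in> sets M \<Longrightarrow> A \<inter> A' = {} \<Longrightarrow> B \<in> sets N \<Longrightarrow> p (A \<union> A') B = p A B + p A' B"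
    and add2: "A \<in> sets M \<Longrightarrow> B \<in> sets N \<Longrightarrow> B' \<in> sets N \<Longrightarrow> B \<inter> B' = {} \<Longrightarrow> p A (B \<union> B') = p A B + p A B'"
begin

lemma empty1: "B \<in> sets N \<Longrightarrow> p {} B = 0"
  using add1[of "{}" "{}" B] by simp

lemma empty2: "A \<in> sets M \<Longrightarrow> p A {} = 0"
  using add2[of A "{}" "{}"] by simp

lemma UN1:
  assumes "finite I" "\<And>i. i \<in> I \<Longrightarrow> A i \<in> sets M" "disjoint_family_on A I" "B \<in> sets N"
  shows "p (\<Union>i\<in>I. A i) B = (\<Sum>i\<in>I. p (A i) B)"
  using assms
proof (induction I rule: finite_induct)
  case (insert i I)
  have "A i \<inter> (\<Union>i\<in>I. A i) = {}" using insert.prems insert.hyps by (auto simp: disjoint_family_on_def)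
  moreover have "(\<Union>i\<in>I. A i) \<in> sets M" using insert by (intro sets.finite_UN) auto
  ultimately show ?case
    using insert by (simp add: add1 disjoint_family_on_mono[of I "insert i I"] subset_insertI)
qed (simp add: empty1)

lemma UN2:
  assumes "finite I" "\<And>i. i \<in> I \<Longrightarrow> B i \<in> sets N" "disjoint_family_on B I" "A \<in> sets M"
  shows "p A (\<Union>i\<in>I. B i) = (\<Sum>i\<in>I. p A (B i))"
  using assms
proof (induction I rule: finite_induct)
  case (insert i I)
  have "B i \<inter> (\<Union>i\<in>I. B i) = {}" using insert.prems insert.hyps by (auto simp: disjoint_family_on_def)
  moreover have "(\<Union>i\<in>I. B i) \<in> sets N" using insert by (intro sets.finite_UN) auto
  ultimately show ?case
    using insert by (simp add: add2 disjoint_family_on_mono[of I "insert i I"] subset_insertI)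
qed (simp add: empty2)

lemma mono1: "A \<in> sets M \<Longrightarrow> A' \<in> sets M \<Longrightarrow> A \<subseteq> A' \<Longrightarrow> B \<in> sets N \<Longrightarrow> p A B \<le> p A' B"
  using add1[of A "A' - A" B] nonneg[of "A' - A" B] by (simp add: Un_absorb1 sets.Diff)

lemma mono2: "A \<in> sets M \<Longrightarrow> B \<in> sets N \<Longrightarrow> B' \<in> sets N \<Longrightarrow> B \<subseteq> B' \<Longrightarrow> p A B \<le> p A B'"
  using add2[of A B "B' - B"] nonneg[of A "B' - B"] by (simp add: Un_absorb1 sets.Diff)

end

text \<open>The nonempty ones among these sets are the atoms of the algebra generated by the finite
  family, each indexed by the members that contain it.\<close>

definition atom :: "'a measure \<Rightarrow> 'i set \<Rightarrow> ('i \<Rightarrow> 'a set) \<Rightarrow> 'i set \<Rightarrow> 'a set"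
  where "atom M I A S = {x \<in> space M. {i\<in>I. x \<in> A i} = S}"

lemma sets_atom:
  assumes "finite I" "\<And>i. i \<in> I \<Longrightarrow> A i \<in> sets M" "S \<subseteq> I"
  shows "atom M I A S \<in> sets M"
proof -
  have "atom M I A S = {x \<in> space M. \<forall>i\<in>I. x \<in> A i \<longleftrightarrow> i \<in> S}"
    using \<open>S \<subseteq> I\<close> by (auto simp: atom_def)
  also have "\<dots> \<in> sets M"
  proof (intro sets.sets_Collect_finite_All \<open>finite I\<close>)
    fix i assume "i \<in> I"
    have "{x \<in> space M. x \<in> A i \<longleftrightarrow> i \<in> S} = (if i \<in> S then A i else space M - A i)"
      using sets.sets_into_space[OF assms(2)[OF \<open>i \<in> I\<close>]] by auto
    then show "{x \<in> space M. x \<in> A i \<longleftrightarrow> i \<in> S} \<in> sets M" using assms(2) \<open>i \<in> I\<close> by auto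
  qed
  finally show ?thesis .
qed

lemma UN_atom:
  assumes "i \<in> I" "A i \<subseteq> space M"
  shows "A i = (\<Union>S\<in>{S \<in> Pow I. i \<in> S}. atom M I A S)"
  using assms by (auto simp: atom_def)

lemma disjoint_atom: "disjoint_family_on (atom M I A) F"
  by (auto simp: disjoint_family_on_def atom_def)

text \<open>Both families are refined to the partitions into atoms, on whose products the sum of the
  coefficients is one of the pointwise values.\<close>

lemma (in biadditive) sum_rectangles_nonneg:
  fixes a :: "'i \<Rightarrow> real"
  assumes I: "finite I" and A: "\<And>i. i \<in> I \<Longrightarrow> A i \<in> sets M" and B: "\<And>i. i \<in> I \<Longrightarrow> B i \<in> sets N"
    and pos: "\<And>x y. x \<in> space M \<Longrightarrow> y \<in> space N \<Longrightarrow> 0 \<le> (\<Sum>i | i \<in> I \<and> x \<in> A i \<and> y \<in> B i. a i)"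
  shows "0 \<le> (\<Sum>i\<in>I. a i * p (A i) (B i))"
proof -
  let ?X = "atom M I A" and ?Y = "atom N I B"
  have X: "?X S \<in> sets M" if "S \<in> Pow I" for S using sets_atom[OF I A] that by auto
  have Y: "?Y S \<in> sets N" if "S \<in> Pow I" for S using sets_atom[OF I B] that by auto
  \<comment> \<open>Additivity in each argument expands the value over the products of atoms inside
    the rectangle. The conditional form lets both sums range over all index sets, so that they can
    be exchanged with the sum over \<open>i\<close>.\<close>
  have "p (A i) (B i) = (\<Sum>S\<in>Pow I. \<Sum>S'\<in>Pow I. if i \<in> S \<and> i \<in> S' then p (?X S) (?Y S') else 0)"
    if i: "i \<in> I" for i
  proof -
    have "p (A i) (B i) = p (\<Union>S\<in>{S \<in> Pow I. i \<in> S}. ?X S) (B i)"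
      using UN_atom[of i I A M] i sets.sets_into_space[OF A[OF i]] by simp
    also have "\<dots> = (\<Sum>S\<in>{S \<in> Pow I. i \<in> S}. p (?X S) (B i))"
      using I X B i disjoint_atom by (intro UN1) auto
    also have "\<dots> = (\<Sum>S\<in>{S \<in> Pow I. i \<in> S}. \<Sum>S'\<in>{S \<in> Pow I. i \<in> S}. p (?X S) (?Y S'))"
    proof (rule sum.cong[OF refl])
      fix S assume S: "S \<in> {S \<in> Pow I. i \<in> S}"
      have "p (?X S) (B i) = p (?X S) (\<Union>S\<in>{S \<in> Pow I. i \<in> S}. ?Y S)"
        using UN_atom[of i I B N] i sets.sets_into_space[OF B[OF i]] by simp
      also have "\<dots> = (\<Sum>S'\<in>{S \<in> Pow I. i \<in> S}. p (?X S) (?Y S'))"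
        using I X[of S] Y i disjoint_atom S by (intro UN2) auto
      finally show "p (?X S) (B i) = (\<Sum>S'\<in>{S \<in> Pow I. i \<in> S}. p (?X S) (?Y S'))" .
    qed
    also have "\<dots> = (\<Sum>S\<in>Pow I. \<Sum>S'\<in>Pow I. if i \<in> S \<and> i \<in> S' then p (?X S) (?Y S') else 0)"
    proof -
      have *: "(\<Sum>S\<in>{S \<in> Pow I. i \<in> S}. f S) = (\<Sum>S\<in>Pow I. if i \<in> S then f S else 0)" for f :: "_ \<Rightarrow> real"
        using I by (intro sum.mono_neutral_cong_left) auto
      show ?thesis unfolding * by (intro sum.cong refl) auto
    qed
    finally show ?thesis .
  qed
  then have "(\<Sum>i\<in>I. a i * p (A i) (B i)) =
      (\<Sum>i\<in>I. \<Sum>S\<in>Pow I. \<Sum>S'\<in>Pow I. if i \<in> S \<and> i \<in> S' then a i * p (?X S) (?Y S') else 0)"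
    by (auto simp: sum_distrib_left intro!: sum.cong)
  also have "\<dots> = (\<Sum>S\<in>Pow I. \<Sum>S'\<in>Pow I. \<Sum>i\<in>I. if i \<in> S \<and> i \<in> S' then a i * p (?X S) (?Y S') else 0)"
    by (subst sum.swap, rule sum.cong[OF refl], rule sum.swap)
  also have "\<dots> \<ge> 0"
  proof (rule sum_nonneg, rule sum_nonneg)
    fix S S' assume S: "S \<in> Pow I" "S' \<in> Pow I"
    have eq: "(\<Sum>i\<in>I. if i \<in> S \<and> i \<in> S' then a i * p (?X S) (?Y S') else 0)
        = (\<Sum>i | i \<in> I \<and> i \<in> S \<and> i \<in> S'. a i) * p (?X S) (?Y S')"
      unfolding sum_distrib_right using I by (intro sum.mono_neutral_cong_right) auto
    have "0 \<le> (\<Sum>i | i \<in> I \<and> i \<in> S \<and> i \<in> S'. a i) * p (?X S) (?Y S')"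
    \<comment> \<open>A product with an empty factor contains no point at which \<open>pos\<close>
      could be evaluated, but there \<open>p\<close> vanishes.\<close>
    proof (cases "?X S = {} \<or> ?Y S' = {}")
      case True
      then show ?thesis using empty1[OF Y[OF S(2)]] empty2[OF X[OF S(1)]] by auto
    next
      case False
      then obtain x y where xy: "x \<in> ?X S" "y \<in> ?Y S'" by auto
      then have "{i. i \<in> I \<and> i \<in> S \<and> i \<in> S'} = {i. i \<in> I \<and> x \<in> A i \<and> y \<in> B i}"
        by (auto simp: atom_def)
      then show ?thesis using pos[of x y] xy nonneg[OF X[OF S(1)] Y[OF S(2)]]
        by (auto simp: atom_def intro!: mult_nonneg_nonneg)
    qed
    then show "0 \<le> (\<Sum>i\<in>I. if i \<in> S \<and> i \<in> S' then a i * p (?X S) (?Y S') else 0)"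
      by (simp only: eq)
  qed
  finally show ?thesis by simp
qed

context biadditive
begin

text \<open>Positivity is applied with coefficient 1 on the large rectangle and -1 on the small
  ones: by disjointness a point lies in at most one small rectangle.\<close>

lemma sum_disjoint_rectangles_le:
  fixes A :: "'i \<Rightarrow> 'a set"
  assumes I: "finite I" and A: "\<And>i. i \<in> I \<Longrightarrow> A i \<in> sets M" and B: "\<And>i. i \<in> I \<Longrightarrow> B i \<in> sets N"
    and A0: "A0 \<in> sets M" and B0: "B0 \<in> sets N"
    and disj: "disjoint_family_on (\<lambda>i. A i \<times> B i) I" and sub: "(\<Union>i\<in>I. A i \<times> B i) \<subseteq> A0 \<times> B0"
  shows "(\<Sum>i\<in>I. p (A i) (B i)) \<le> p A0 B0"
proof -
  \<comment> \<open>\<open>None\<close> indexes the large rectangle \<open>A0 \<times> B0\<close>,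
    and \<open>Some i\<close> the small ones.\<close>
  let ?I = "insert None (Some ` I)"
  have sum: "(\<Sum>i\<in>?I. f i) = f None + (\<Sum>i\<in>I. f (Some i))" for f :: "'i option \<Rightarrow> real"
    using I by (simp add: sum.reindex)
  define a where "a = case_option (1::real) (\<lambda>_::'i. - 1)"
  have "0 \<le> (\<Sum>i\<in>?I. a i * p (case_option A0 A i) (case_option B0 B i))"
  proof (rule sum_rectangles_nonneg)
    fix x y
    have "(\<Sum>i | i \<in> ?I \<and> x \<in> case_option A0 A i \<and> y \<in> case_option B0 B i. a i)
      = (\<Sum>i\<in>?I. if x \<in> case_option A0 A i \<and> y \<in> case_option B0 B i then a i else 0)"
      using I by (intro sum.mono_neutral_cong_left) auto
    also have "\<dots> = (if x \<in> A0 \<and> y \<in> B0 then 1 else 0) - (\<Sum>i\<in>I. if x \<in> A i \<and> y \<in> B i then 1 else 0)"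
      unfolding sum by (simp add: a_def if_distrib sum_negf[symmetric] cong: if_cong)
    also have "\<dots> \<ge> 0"
    proof (cases "\<exists>i\<in>I. x \<in> A i \<and> y \<in> B i")
      case True
      then obtain k where k: "k \<in> I" "x \<in> A k" "y \<in> B k" by auto
      then have "(x \<in> A i \<and> y \<in> B i) = (i = k)" if "i \<in> I" for i
        using disj that by (auto simp: disjoint_family_on_def)
      then have "(\<Sum>i\<in>I. if x \<in> A i \<and> y \<in> B i then 1 else 0) = (\<Sum>i\<in>I. if i = k then 1 else (0::real))"
        by (intro sum.cong) auto
      then show ?thesis using k sub I by auto
    next
      case False
      then have "(\<Sum>i\<in>I. if x \<in> A i \<and> y \<in> B i then 1 else (0::real)) = 0"
        by (intro sum.neutral) auto
      then show ?thesis by simp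
    qed
    finally show "0 \<le> (\<Sum>i | i \<in> ?I \<and> x \<in> case_option A0 A i \<and> y \<in> case_option B0 B i. a i)" .
  qed (use assms in auto)
  then show ?thesis unfolding sum by (simp add: a_def sum_negf)
qed

text \<open>The same combination with opposite signs: each point of the covered rectangle lies in at
  least one of the covering ones.\<close>

lemma le_sum_rectangles:
  fixes A :: "'i \<Rightarrow> 'a set"
  assumes I: "finite I" and A: "\<And>i. i \<in> I \<Longrightarrow> A i \<in> sets M" and B: "\<And>i. i \<in> I \<Longrightarrow> B i \<in> sets N"
    and A0: "A0 \<in> sets M" and B0: "B0 \<in> sets N"
    and sub: "A0 \<times> B0 \<subseteq> (\<Union>i\<in>I. A i \<times> B i)"
  shows "p A0 B0 \<le> (\<Sum>i\<in>I. p (A i) (B i))"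
proof -
  let ?I = "insert None (Some ` I)"
  have sum: "(\<Sum>i\<in>?I. f i) = f None + (\<Sum>i\<in>I. f (Some i))" for f :: "'i option \<Rightarrow> real"
    using I by (simp add: sum.reindex)
  define a where "a = case_option (- 1::real) (\<lambda>_::'i. 1)"
  have "0 \<le> (\<Sum>i\<in>?I. a i * p (case_option A0 A i) (case_option B0 B i))"
  proof (rule sum_rectangles_nonneg)
    fix x y
    have "(\<Sum>i | i \<in> ?I \<and> x \<in> case_option A0 A i \<and> y \<in> case_option B0 B i. a i)
      = (\<Sum>i\<in>?I. if x \<in> case_option A0 A i \<and> y \<in> case_option B0 B i then a i else 0)"
      using I by (intro sum.mono_neutral_cong_left) auto
    also have "\<dots> = (\<Sum>i\<in>I. if x \<in> A i \<and> y \<in> B i then 1 else 0) - (if x \<in> A0 \<and> y \<in> B0 then 1 else 0)"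
      unfolding sum by (simp add: a_def cong: if_cong)
    also have "\<dots> \<ge> 0"
    proof (cases "x \<in> A0 \<and> y \<in> B0")
      case True
      then obtain k where k: "k \<in> I" "x \<in> A k" "y \<in> B k" using sub by auto
      have "(if x \<in> A k \<and> y \<in> B k then 1 else 0) \<le> (\<Sum>i\<in>I. if x \<in> A i \<and> y \<in> B i then 1 else (0::real))"
        using k I by (intro member_le_sum) auto
      then show ?thesis using k True by auto
    next
      case False
      then show ?thesis by (auto intro!: sum_nonneg)
    qed
    finally show "0 \<le> (\<Sum>i | i \<in> ?I \<and> x \<in> case_option A0 A i \<and> y \<in> case_option B0 B i. a i)" .
  qed (use assms in auto)
  then show ?thesis unfolding sum by (simp add: a_def)
qed

end

section \<open>Caratheodory extension to transport plans\<close>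

lemma semiring_of_rectangles:
  "semiring_of_sets (space M \<times> space N) {A \<times> B |A B. A \<in> sets M \<and> B \<in> sets N}" (is "semiring_of_sets _ ?R")
proof
  show "?R \<subseteq> Pow (space M \<times> space N)" by (auto dest: sets.sets_into_space)
  show "{} \<in> ?R" by blast
  fix a b assume "a \<in> ?R" "b \<in> ?R"
  then obtain A B A' B' where a: "a = A \<times> B" "A \<in> sets M" "B \<in> sets N"
    and b: "b = A' \<times> B'" "A' \<in> sets M" "B' \<in> sets N" by blast
  show "a \<inter> b \<in> ?R" unfolding a b Times_Int_Times using a b by blast
  \<comment> \<open>The difference splits into the part off \<open>A'\<close> and, over
    \<open>A \<inter> A'\<close>, the part off \<open>B'\<close>.\<close>
  let ?C = "{(A - A') \<times> B, (A \<inter> A') \<times> (B - B')}"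
  have "(A - A') \<times> B \<in> ?R" "(A \<inter> A') \<times> (B - B') \<in> ?R" using a b by blast+
  then have "?C \<subseteq> ?R" by (intro insert_subsetI empty_subsetI)
  moreover have "finite ?C" by simp
  moreover have "disjoint ?C" by (auto simp: disjoint_def)
  moreover have "a - b = \<Union> ?C" unfolding a b by auto
  ultimately show "\<exists>C\<subseteq>?R. finite C \<and> disjoint C \<and> a - b = \<Union> C"
    by (intro exI[of _ ?C] conjI)
qed

text \<open>Countable additivity on rectangles: they are approximated from inside by compact and from outside by
  open ones, with an error that the marginals control.\<close>

lemma exists_transport_plan:
  fixes X :: "'a::metric_space set" and Y :: "'b::metric_space set"
  assumes X: "compact X" and \<mu>: "prob_space \<mu>" and s\<mu>: "sets \<mu> = sets (restrict_space borel X)"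
    and Y: "compact Y" and \<nu>: "prob_space \<nu>" and s\<nu>: "sets \<nu> = sets (restrict_space borel Y)"
    and p: "biadditive \<mu> \<nu> p"
    and p1: "\<And>A. A \<in> sets \<mu> \<Longrightarrow> p A Y = measure \<mu> A"
    and p2: "\<And>B. B \<in> sets \<nu> \<Longrightarrow> p X B = measure \<nu> B"
  obtains \<pi> where "\<pi> \<in> transport_plans X Y \<mu> \<nu>"
    "\<And>A B. A \<in> sets \<mu> \<Longrightarrow> B \<in> sets \<nu> \<Longrightarrow> measure \<pi> (A \<times> B) = p A B"
proof -
  interpret M: prob_space \<mu> by fact
  interpret N: prob_space \<nu> by fact
  interpret biadditive \<mu> \<nu> p by fact
  have spM: "space \<mu> = X" using sets_eq_imp_space_eq[OF s\<mu>] by (simp add: space_restrict_space)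
  have spN: "space \<nu> = Y" using sets_eq_imp_space_eq[OF s\<nu>] by (simp add: space_restrict_space)
  have inM: "S \<in> sets \<mu> \<longleftrightarrow> S \<in> sets borel \<and> S \<subseteq> X" for S
    unfolding s\<mu> by (rule sets_restrict_borel_compact[OF X])
  have inN: "S \<in> sets \<nu> \<longleftrightarrow> S \<in> sets borel \<and> S \<subseteq> Y" for S
    unfolding s\<nu> by (rule sets_restrict_borel_compact[OF Y])
  have XY: "X \<in> sets \<mu>" "Y \<in> sets \<nu>" using sets.top[of \<mu>] sets.top[of \<nu>] by (auto simp: spM spN)
  define R where "R = {A \<times> B |A B. A \<in> sets \<mu> \<and> B \<in> sets \<nu>}"
  \<comment> \<open>The projections recover the factors of a nonempty rectangle. For an empty one
    the factors are lost, but every choice gives the value 0.\<close>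
  define P where "P S = ennreal (p (fst ` S) (snd ` S))" for S
  have P: "P (A \<times> B) = ennreal (p A B)" if "A \<in> sets \<mu>" "B \<in> sets \<nu>" for A B
    using that empty1 empty2 by (cases "A = {} \<or> B = {}") (auto simp: P_def)
  interpret R: semiring_of_sets "X \<times> Y" R
    using semiring_of_rectangles[of \<mu> \<nu>] by (simp add: R_def spM spN)
  \<comment> \<open>The difference of the rectangles splits into two strips. Enlarged to full strips
    over \<open>A' - A\<close> and \<open>B' - B\<close>, they have masses given by the
    marginals.\<close>
  have diff: "p A' B' \<le> p A B + measure \<mu> (A' - A) + measure \<nu> (B' - B)"
    if "A \<in> sets \<mu>" "A' \<in> sets \<mu>" "A \<subseteq> A'" "B \<in> sets \<nu>" "B' \<in> sets \<nu>" "B \<subseteq> B'" for A A' B B'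
  proof -
    have "p A' B' = p A B' + p (A' - A) B'" using add1[of A "A' - A" B'] that by (simp add: Un_absorb1)
    moreover have "p A B' = p A B + p A (B' - B)" using add2[of A B "B' - B"] that by (simp add: Un_absorb1)
    moreover have "p (A' - A) B' \<le> p (A' - A) Y" using that inN XY by (intro mono2) auto
    moreover have "p A (B' - B) \<le> p X (B' - B)" using that inM XY by (intro mono1) auto
    moreover have "A' - A \<in> sets \<mu>" "B' - B \<in> sets \<nu>" using that by auto
    ultimately show ?thesis using p1 p2 by auto
  qed
  have "countably_additive R P" unfolding countably_additive_def
  proof (intro allI impI)
    fix S :: "nat \<Rightarrow> ('a \<times> 'b) set"
    assume S: "range S \<subseteq> R" and dS: "disjoint_family S" and US: "(\<Union>i. S i) \<in> R"
    have "\<forall>i. \<exists>A B. A \<in> sets \<mu> \<and> B \<in> sets \<nu> \<and> S i = A \<times> B"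
      using S unfolding R_def by blast
    then obtain A B where AB: "\<And>i. A i \<in> sets \<mu>" "\<And>i. B i \<in> sets \<nu>" "\<And>i. S i = A i \<times> B i" by metis
    obtain A0 B0 where AB0: "A0 \<in> sets \<mu>" "B0 \<in> sets \<nu>" "(\<Union>i. S i) = A0 \<times> B0"
      using US unfolding R_def by blast
    have nn: "0 \<le> p (A i) (B i)" for i using AB by (intro nonneg) auto
    have le: "(\<Sum>i<n. p (A i) (B i)) \<le> p A0 B0" for n
    proof (rule sum_disjoint_rectangles_le)
      show "disjoint_family_on (\<lambda>i. A i \<times> B i) {..<n}"
        using dS unfolding AB(3)[symmetric] by (auto simp: disjoint_family_on_def)
      show "(\<Union>i<n. A i \<times> B i) \<subseteq> A0 \<times> B0" unfolding AB0(3)[symmetric] AB(3) by blast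
    qed (use AB AB0 in auto)
    have sm: "summable (\<lambda>i. p (A i) (B i))" by (rule summableI_nonneg_bounded[OF nn le])
    \<comment> \<open>This is the half of countable additivity that needs compactness; the opposite
      inequality follows from the finite families in \<open>le\<close>.\<close>
    have "p A0 B0 \<le> (\<Sum>i. p (A i) (B i))"
    proof (rule field_le_epsilon)
      fix e :: real assume e: "0 < e"
      \<comment> \<open>\<open>e\<close> is spent in quarters: one for each of the inner sets
        \<open>K\<close> and \<open>L\<close>, and one for the total enlargement in each
        factor.\<close>
      define d where "d n = e / 4 * (1/2) ^ Suc n" for n :: nat
      have dpos: "0 < d n" for n unfolding d_def using e by simp
      have dsum: "d sums (e / 4)"
        unfolding d_def using sums_mult[OF power_half_series, of "e/4"] by simp
      obtain K where K: "closed K" "K \<subseteq> A0" "measure \<mu> (A0 - K) \<le> e / 4"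
      proof -
        obtain K U where *: "closed K" "open U" "K \<subseteq> A0" "A0 \<subseteq> U" "measure \<mu> (U \<inter> X - K) < e / 4"
          using regular_compact[OF X M.finite_measure_axioms s\<mu> AB0(1), of "e/4"] e by auto
        have "measure \<mu> (A0 - K) \<le> measure \<mu> (U \<inter> X - K)"
          using * AB0(1) XY by (intro M.finite_measure_mono) (auto simp: inM borel_open borel_closed)
        then show ?thesis using that[of K] * by auto
      qed
      obtain L where L: "closed L" "L \<subseteq> B0" "measure \<nu> (B0 - L) \<le> e / 4"
      proof -
        obtain K U where *: "closed K" "open U" "K \<subseteq> B0" "B0 \<subseteq> U" "measure \<nu> (U \<inter> Y - K) < e / 4"
          using regular_compact[OF Y N.finite_measure_axioms s\<nu> AB0(2), of "e/4"] e by auto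
        have "measure \<nu> (B0 - K) \<le> measure \<nu> (U \<inter> Y - K)"
          using * AB0(2) XY by (intro N.finite_measure_mono) (auto simp: inN borel_open borel_closed)
        then show ?thesis using that[of K] * by auto
      qed
      have "\<exists>U. open U \<and> A n \<subseteq> U \<and> measure \<mu> (U \<inter> X - A n) \<le> d n" for n
      proof -
        obtain K U where *: "closed K" "open U" "K \<subseteq> A n" "A n \<subseteq> U" "measure \<mu> (U \<inter> X - K) < d n"
          using regular_compact[OF X M.finite_measure_axioms s\<mu> AB(1) dpos, of n] by auto
        have "measure \<mu> (U \<inter> X - A n) \<le> measure \<mu> (U \<inter> X - K)"
          using * XY by (intro M.finite_measure_mono) (auto simp: inM borel_open borel_closed)
        then show ?thesis using * by (intro exI[of _ U]) auto
      qed
      then obtain U where U: "\<And>n. open (U n)" "\<And>n. A n \<subseteq> U n" "\<And>n. measure \<mu> (U n \<inter> X - A n) \<le> d n"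
        by metis
      have "\<exists>U. open U \<and> B n \<subseteq> U \<and> measure \<nu> (U \<inter> Y - B n) \<le> d n" for n
      proof -
        obtain K U where *: "closed K" "open U" "K \<subseteq> B n" "B n \<subseteq> U" "measure \<nu> (U \<inter> Y - K) < d n"
          using regular_compact[OF Y N.finite_measure_axioms s\<nu> AB(2) dpos, of n] by auto
        have "measure \<nu> (U \<inter> Y - B n) \<le> measure \<nu> (U \<inter> Y - K)"
          using * XY by (intro N.finite_measure_mono) (auto simp: inN borel_open borel_closed)
        then show ?thesis using * by (intro exI[of _ U]) auto
      qed
      then obtain V where V: "\<And>n. open (V n)" "\<And>n. B n \<subseteq> V n" "\<And>n. measure \<nu> (V n \<inter> Y - B n) \<le> d n"
        by metis
      have KL: "K \<in> sets \<mu>" "L \<in> sets \<nu>"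
        using K L AB0 by (auto simp: inM inN borel_closed)
      have UV: "U n \<inter> X \<in> sets \<mu>" "V n \<inter> Y \<in> sets \<nu>" for n
        using U V XY by (auto simp: inM inN borel_open)
      have sub: "A n \<subseteq> X" "B n \<subseteq> Y" for n using AB inM inN by auto
      have "compact K" "compact L"
        using compact_Int_closed[OF X K(1)] compact_Int_closed[OF Y L(1)] KL inM inN
        by (auto simp: Int_absorb1)
      then have "compact (K \<times> L)" by (rule compact_Times)
      moreover have "K \<times> L \<subseteq> (\<Union>n\<in>UNIV. U n \<times> V n)"
      proof -
        have "K \<times> L \<subseteq> (\<Union>n. A n \<times> B n)" using K(2) L(2) AB0(3) unfolding AB(3) by blast
        also have "\<dots> \<subseteq> (\<Union>n. U n \<times> V n)" by (intro UN_mono Sigma_mono U(2) V(2) subset_refl)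
        finally show ?thesis .
      qed
      \<comment> \<open>Compactness of \<open>K \<times> L\<close> reduces the countable cover to a
        finite one, to which finite subadditivity applies.\<close>
      ultimately obtain J where J: "finite J" "K \<times> L \<subseteq> (\<Union>n\<in>J. U n \<times> V n)"
        using U(1) V(1) by (elim compactE_image) (auto intro: open_Times)
      have "p A0 B0 \<le> p K L + e / 4 + e / 4"
        using diff[OF KL(1) AB0(1) K(2) KL(2) AB0(2) L(2)] K(3) L(3) by simp
      also have "p K L \<le> (\<Sum>n\<in>J. p (U n \<inter> X) (V n \<inter> Y))"
      proof (rule le_sum_rectangles)
        have "K \<subseteq> X" "L \<subseteq> Y" using KL by (simp_all add: inM inN)
        then show "K \<times> L \<subseteq> (\<Union>n\<in>J. (U n \<inter> X) \<times> (V n \<inter> Y))" using J(2) by blast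
      qed (use J KL UV in auto)
      also have "\<dots> \<le> (\<Sum>n\<in>J. p (A n) (B n) + d n + d n)"
      proof (rule sum_mono)
        fix n
        have "p (U n \<inter> X) (V n \<inter> Y) \<le> p (A n) (B n) + measure \<mu> (U n \<inter> X - A n) + measure \<nu> (V n \<inter> Y - B n)"
          using U V sub by (intro diff UV AB) auto
        then show "p (U n \<inter> X) (V n \<inter> Y) \<le> p (A n) (B n) + d n + d n"
          using U(3)[of n] V(3)[of n] by simp
      qed
      also have "\<dots> = (\<Sum>n\<in>J. p (A n) (B n)) + (\<Sum>n\<in>J. d n) + (\<Sum>n\<in>J. d n)"
        by (simp add: sum.distrib sum_distrib_left)
      finally have "p A0 B0 \<le> (\<Sum>n\<in>J. p (A n) (B n)) + (\<Sum>n\<in>J. d n) + (\<Sum>n\<in>J. d n) + e / 4 + e / 4"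
        by simp
      moreover have "(\<Sum>n\<in>J. p (A n) (B n)) \<le> (\<Sum>n. p (A n) (B n))"
        using sm J(1) nn by (intro sum_le_suminf) auto
      moreover have "(\<Sum>n\<in>J. d n) \<le> e / 4"
        unfolding sums_unique[OF dsum] using J(1) dpos
        by (intro sum_le_suminf sums_summable[OF dsum]) (auto intro: less_imp_le)
      ultimately show "p A0 B0 \<le> (\<Sum>i. p (A i) (B i)) + e" by simp
    qed
    moreover have "(\<Sum>i. p (A i) (B i)) \<le> p A0 B0" using sm le by (rule suminf_le_const)
    ultimately have "(\<lambda>i. p (A i) (B i)) sums p A0 B0" using sm by (simp add: sums_iff)
    then have "(\<lambda>i. ennreal (p (A i) (B i))) sums ennreal (p A0 B0)"
      using nn AB0 by (subst sums_ennreal) (auto intro: nonneg)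
    then show "(\<Sum>i. P (S i)) = P (\<Union>i. S i)"
      unfolding AB0(3) using AB AB0 P by (simp add: sums_iff)
  qed
  moreover have "positive R P" using P[of "{}" "{}"] empty1[of "{}"] by (simp add: positive_def)
  ultimately obtain m where m: "\<And>S. S \<in> R \<Longrightarrow> m S = P S" "measure_space (X \<times> Y) (sigma_sets (X \<times> Y) R) m"
    using R.caratheodory by metis
  define \<pi> where "\<pi> = measure_of (X \<times> Y) (sigma_sets (X \<times> Y) R) m"
  have "sets (\<mu> \<Otimes>\<^sub>M \<nu>) = sigma_sets (X \<times> Y) R" by (simp add: sets_pair_measure spM spN R_def)
  moreover have "sets (\<mu> \<Otimes>\<^sub>M \<nu>) = sets (restrict_space borel X \<Otimes>\<^sub>M restrict_space borel Y)"
    by (intro sets_pair_measure_cong s\<mu> s\<nu>)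
  ultimately have sig: "sigma_sets (X \<times> Y) R = sets (restrict_space borel X \<Otimes>\<^sub>M restrict_space borel Y)" by simp
  have s\<pi>: "sets \<pi> = sigma_sets (X \<times> Y) R" and sp\<pi>: "space \<pi> = X \<times> Y"
    using R.space_closed by (simp_all add: \<pi>_def sigma_sets_sigma_sets_eq sets_measure_of_conv space_measure_of_conv)
      (auto dest: sigma_sets_into_sp)
  have em: "emeasure \<pi> (A \<times> B) = ennreal (p A B)" if "A \<in> sets \<mu>" "B \<in> sets \<nu>" for A B
  proof -
    have AB: "A \<times> B \<in> R" using that by (auto simp: R_def)
    have "emeasure \<pi> (A \<times> B) = m (A \<times> B)"
      unfolding \<pi>_def using m(2) AB
      by (intro emeasure_measure_of_sigma) (auto simp: measure_space_def)
    then show ?thesis using m(1)[OF AB] P[OF that] by simp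
  qed
  have ms: "measure \<pi> (A \<times> B) = p A B" if "A \<in> sets \<mu>" "B \<in> sets \<nu>" for A B
    using em[OF that] nonneg[OF that] by (simp add: measure_def)
  have fstm: "fst \<in> measurable \<pi> (restrict_space borel X)" and sndm: "snd \<in> measurable \<pi> (restrict_space borel Y)"
    using s\<pi> sig by (auto simp: measurable_cong_sets[of \<pi> "restrict_space borel X \<Otimes>\<^sub>M restrict_space borel Y"])
  have "distr \<pi> (restrict_space borel X) fst = \<mu>"
  proof (rule measure_eqI)
    fix A assume "A \<in> sets (distr \<pi> (restrict_space borel X) fst)"
    then have A: "A \<in> sets \<mu>" by (simp add: s\<mu>)
    have "fst -` A \<inter> space \<pi> = A \<times> Y" using A inM by (auto simp: sp\<pi>)
    then show "emeasure (distr \<pi> (restrict_space borel X) fst) A = emeasure \<mu> A"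
      using A XY p1 em fstm by (simp add: emeasure_distr s\<mu> M.emeasure_eq_measure)
  qed (simp add: s\<mu>)
  moreover have "distr \<pi> (restrict_space borel Y) snd = \<nu>"
  proof (rule measure_eqI)
    fix A assume "A \<in> sets (distr \<pi> (restrict_space borel Y) snd)"
    then have A: "A \<in> sets \<nu>" by (simp add: s\<nu>)
    have "snd -` A \<inter> space \<pi> = X \<times> A" using A inN by (auto simp: sp\<pi>)
    then show "emeasure (distr \<pi> (restrict_space borel Y) snd) A = emeasure \<nu> A"
      using A XY p2 em sndm by (simp add: emeasure_distr s\<nu> N.emeasure_eq_measure)
  qed (simp add: s\<nu>)
  moreover have "prob_space \<pi>"
    using em[OF XY] p1[OF XY(1)] M.prob_space by (intro prob_spaceI) (simp add: sp\<pi> spM)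
  moreover have "sets \<pi> = sets (restrict_space borel (X \<times> Y))"
    unfolding s\<pi> sig by (rule sets_pair_restrict_borel[OF X Y])
  ultimately have "\<pi> \<in> transport_plans X Y \<mu> \<nu>" by (simp add: transport_plans_def)
  then show ?thesis using ms by (rule that)
qed

lemma h_partition_sum_delta:
  fixes f :: "nat \<Rightarrow> 'c::comm_monoid_add"
  assumes "h_partition Z h P" "k \<in> idx P" "x \<in> cell P k"
  shows "(\<Sum>i\<in>idx P. if x \<in> cell P i then f i else 0) = f k"
proof -
  have "(x \<in> cell P i) = (i = k)" if "i \<in> idx P" for i
    using assms that by (auto simp: h_partition_def disjoint_family_on_def)
  then have "(\<Sum>i\<in>idx P. if x \<in> cell P i then f i else 0) = (\<Sum>i\<in>idx P. if i = k then f i else 0)"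
    by (intro sum.cong) auto
  then show ?thesis using assms by (simp add: h_partition_def)
qed

lemma sum_measure_Int_cells:
  fixes M :: "'a::metric_space measure"
  assumes "finite_measure M" and P: "h_partition (space M) h P" "sets M = sets (restrict_space borel (space M))" and A: "A \<in> sets M"
  shows "(\<Sum>i\<in>idx P. measure M (A \<inter> cell P i)) = measure M A"
proof -
  interpret finite_measure M by fact
  have "(\<Sum>i\<in>idx P. measure M (A \<inter> cell P i)) = measure M (\<Union>i\<in>idx P. A \<inter> cell P i)"
    using P A by (intro finite_measure_finite_Union[symmetric])
      (auto simp: h_partition_def disjoint_family_on_def)
  also have "(\<Union>i\<in>idx P. A \<inter> cell P i) = A"
    using P(1) sets.sets_into_space[OF A] by (auto simp: h_partition_def)
  finally show ?thesis .
qed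

subsection \<open>Discrete and continuous plans\<close>

locale compact_OT =
  fixes X :: "'a::metric_space set" and Y :: "'b::metric_space set"
    and \<mu> :: "'a measure" and \<nu> :: "'b measure" and c :: "'a \<times> 'b \<Rightarrow> real"
  assumes OT: "compact_OT_problem X Y \<mu> \<nu> c"
begin

lemma compact_X: "compact X" and compact_Y: "compact Y"
  and sets_\<mu>: "sets \<mu> = sets (restrict_space borel X)" and sets_\<nu>: "sets \<nu> = sets (restrict_space borel Y)"
  and continuous_cost: "continuous_on (X \<times> Y) c"
  using OT by (auto simp: compact_OT_problem_def)

sublocale \<mu>: prob_space \<mu> using OT by (simp add: compact_OT_problem_def)
sublocale \<nu>: prob_space \<nu> using OT by (simp add: compact_OT_problem_def)

lemma space_\<mu>: "space \<mu> = X" using sets_eq_imp_space_eq[OF sets_\<mu>] by (simp add: space_restrict_space)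
lemma space_\<nu>: "space \<nu> = Y" using sets_eq_imp_space_eq[OF sets_\<nu>] by (simp add: space_restrict_space)

lemma X_sets: "X \<in> sets \<mu>" using sets.top[of \<mu>] by (simp add: space_\<mu>)

lemma sets_pair: "sets (restrict_space borel (X \<times> Y)) = sets (\<mu> \<Otimes>\<^sub>M \<nu>)"
  using sets_pair_restrict_borel[OF compact_X compact_Y] sets_pair_measure_cong[OF sets_\<mu> sets_\<nu>] by simp

lemma
  assumes "\<pi> \<in> transport_plans X Y \<mu> \<nu>"
  shows plan_prob: "prob_space \<pi>" and plan_sets: "sets \<pi> = sets (\<mu> \<Otimes>\<^sub>M \<nu>)" and plan_space: "space \<pi> = X \<times> Y"
    and plan_distr_fst: "distr \<pi> (restrict_space borel X) fst = \<mu>"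
    and plan_distr_snd: "distr \<pi> (restrict_space borel Y) snd = \<nu>"
proof -
  show "prob_space \<pi>" "distr \<pi> (restrict_space borel X) fst = \<mu>" "distr \<pi> (restrict_space borel Y) snd = \<nu>"
    using assms by (auto simp: transport_plans_def)
  show *: "sets \<pi> = sets (\<mu> \<Otimes>\<^sub>M \<nu>)" using assms sets_pair by (auto simp: transport_plans_def)
  show "space \<pi> = X \<times> Y" using sets_eq_imp_space_eq[OF *] by (simp add: space_pair_measure space_\<mu> space_\<nu>)
qed

lemma plan_measurable:
  assumes "\<pi> \<in> transport_plans X Y \<mu> \<nu>"
  shows "measurable \<pi> N = measurable (\<mu> \<Otimes>\<^sub>M \<nu>) N"
  by (rule measurable_cong_sets[OF plan_sets[OF assms] refl])

lemma plan_Times: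
  assumes "\<pi> \<in> transport_plans X Y \<mu> \<nu>" "A \<in> sets \<mu>" "B \<in> sets \<nu>"
  shows "A \<times> B \<in> sets \<pi>"
  using assms by (simp add: plan_sets)

lemma plan_fst: "\<pi> \<in> transport_plans X Y \<mu> \<nu> \<Longrightarrow> fst \<in> measurable \<pi> \<mu>"
  and plan_snd: "\<pi> \<in> transport_plans X Y \<mu> \<nu> \<Longrightarrow> snd \<in> measurable \<pi> \<nu>"
  by (simp_all add: plan_measurable)

lemma plan_distr_fst': "\<pi> \<in> transport_plans X Y \<mu> \<nu> \<Longrightarrow> distr \<pi> \<mu> fst = \<mu>"
  and plan_distr_snd': "\<pi> \<in> transport_plans X Y \<mu> \<nu> \<Longrightarrow> distr \<pi> \<nu> snd = \<nu>"
  using plan_distr_fst[of \<pi>] plan_distr_snd[of \<pi>] by (simp_all add: sets_\<mu> sets_\<nu> cong: distr_cong)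

lemma plan_marginal1:
  assumes \<pi>: "\<pi> \<in> transport_plans X Y \<mu> \<nu>" and A: "A \<in> sets \<mu>"
  shows "measure \<pi> (A \<times> Y) = measure \<mu> A"
proof -
  have "measure \<mu> A = measure (distr \<pi> \<mu> fst) A" using plan_distr_fst'[OF \<pi>] by simp
  also have "\<dots> = measure \<pi> (fst -` A \<inter> space \<pi>)" using A plan_fst[OF \<pi>] by (simp add: measure_distr)
  also have "fst -` A \<inter> space \<pi> = A \<times> Y" using sets.sets_into_space[OF A] by (auto simp: plan_space[OF \<pi>] space_\<mu>)
  finally show ?thesis by simp
qed

lemma plan_marginal2:
  assumes \<pi>: "\<pi> \<in> transport_plans X Y \<mu> \<nu>" and B: "B \<in> sets \<nu>"
  shows "measure \<pi> (X \<times> B) = measure \<nu> B"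
proof -
  have "measure \<nu> B = measure (distr \<pi> \<nu> snd) B" using plan_distr_snd'[OF \<pi>] by simp
  also have "\<dots> = measure \<pi> (snd -` B \<inter> space \<pi>)" using B plan_snd[OF \<pi>] by (simp add: measure_distr)
  also have "snd -` B \<inter> space \<pi> = X \<times> B" using sets.sets_into_space[OF B] by (auto simp: plan_space[OF \<pi>] space_\<nu>)
  finally show ?thesis by simp
qed

lemma plan_biadditive:
  assumes \<pi>: "\<pi> \<in> transport_plans X Y \<mu> \<nu>"
  shows "biadditive \<mu> \<nu> (\<lambda>A B. measure \<pi> (A \<times> B))"
proof -
  interpret prob_space \<pi> by (rule plan_prob[OF \<pi>])
  show ?thesis
  proof
    fix A A' B assume *: "A \<in> sets \<mu>" "A' \<in> sets \<mu>" "A \<inter> A' = {}" "B \<in> sets \<nu>"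
    have "(A \<union> A') \<times> B = A \<times> B \<union> A' \<times> B" by auto
    moreover have "A \<times> B \<inter> A' \<times> B = {}" using * by auto
    ultimately show "measure \<pi> ((A \<union> A') \<times> B) = measure \<pi> (A \<times> B) + measure \<pi> (A' \<times> B)"
      using * by (simp add: finite_measure_Union plan_Times[OF \<pi>])
  next
    fix A B B' assume *: "A \<in> sets \<mu>" "B \<in> sets \<nu>" "B' \<in> sets \<nu>" "B \<inter> B' = {}"
    have "A \<times> (B \<union> B') = A \<times> B \<union> A \<times> B'" by auto
    moreover have "A \<times> B \<inter> A \<times> B' = {}" using * by auto
    ultimately show "measure \<pi> (A \<times> (B \<union> B')) = measure \<pi> (A \<times> B) + measure \<pi> (A \<times> B')"
      using * by (simp add: finite_measure_Union plan_Times[OF \<pi>])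
  qed simp
qed

lemma partition1_sets: "h_partition X h P \<Longrightarrow> i \<in> idx P \<Longrightarrow> cell P i \<in> sets \<mu>"
  and partition2_sets: "h_partition Y h R \<Longrightarrow> j \<in> idx R \<Longrightarrow> cell R j \<in> sets \<nu>"
  by (auto simp: h_partition_def sets_\<mu> sets_\<nu>)

lemma sum_cells1: "h_partition X h P \<Longrightarrow> A \<in> sets \<mu> \<Longrightarrow> (\<Sum>i\<in>idx P. measure \<mu> (A \<inter> cell P i)) = measure \<mu> A"
  using sum_measure_Int_cells[OF \<mu>.finite_measure_axioms, of h P A] by (simp add: space_\<mu> sets_\<mu>)

lemma sum_cells2: "h_partition Y h R \<Longrightarrow> B \<in> sets \<nu> \<Longrightarrow> (\<Sum>j\<in>idx R. measure \<nu> (B \<inter> cell R j)) = measure \<nu> B"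
  using sum_measure_Int_cells[OF \<nu>.finite_measure_axioms, of h R B] by (simp add: space_\<nu> sets_\<nu>)

definition matched :: "('a, 'b) discrete_plan \<Rightarrow> ('a \<times> 'b) measure \<Rightarrow> bool"
  where "matched D \<pi> \<longleftrightarrow> h_plan X Y \<mu> \<nu> D \<and> \<pi> \<in> transport_plans X Y \<mu> \<nu> \<and>
    (\<forall>i\<in>idx (src D). \<forall>j\<in>idx (tgt D). measure \<pi> (cell (src D) i \<times> cell (tgt D) j) = wt D i j)"

text \<open>By finite additivity over the cells, the row and column sums are the marginals.
  \<open>D\<close> supplies the mesh and the partitions; its weights are overwritten.\<close>

lemma matched_discretization:
  assumes P: "h_partition X (mesh D) (src D)" and R: "h_partition Y (mesh D) (tgt D)"
    and \<pi>: "\<pi> \<in> transport_plans X Y \<mu> \<nu>"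
  shows "matched (D\<lparr>wt := \<lambda>i j. measure \<pi> (cell (src D) i \<times> cell (tgt D) j)\<rparr>) \<pi>"
proof -
  interpret biadditive \<mu> \<nu> "\<lambda>A B. measure \<pi> (A \<times> B)" by (rule plan_biadditive[OF \<pi>])
  have P': "finite (idx (src D))" "disjoint_family_on (cell (src D)) (idx (src D))" "(\<Union>i\<in>idx (src D). cell (src D) i) = X"
    and R': "finite (idx (tgt D))" "disjoint_family_on (cell (tgt D)) (idx (tgt D))" "(\<Union>i\<in>idx (tgt D). cell (tgt D) i) = Y"
    using P R by (auto simp: h_partition_def)
  have "(\<Sum>j\<in>idx (tgt D). measure \<pi> (cell (src D) i \<times> cell (tgt D) j)) = measure \<mu> (cell (src D) i)"
    if "i \<in> idx (src D)" for i
    using UN2[OF R'(1) partition2_sets[OF R] R'(2) partition1_sets[OF P that]] R'(3)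
      plan_marginal1[OF \<pi> partition1_sets[OF P that]] by simp
  moreover have "(\<Sum>i\<in>idx (src D). measure \<pi> (cell (src D) i \<times> cell (tgt D) j)) = measure \<nu> (cell (tgt D) j)"
    if "j \<in> idx (tgt D)" for j
    using UN1[OF P'(1) partition1_sets[OF P] P'(2) partition2_sets[OF R that]] P'(3)
      plan_marginal2[OF \<pi> partition2_sets[OF R that]] by simp
  ultimately show ?thesis using P R \<pi> by (simp add: matched_def h_plan_def)
qed

text \<open>On each product of cells the plan is the multiple of the product of \<mu> and \<nu> with
  the prescribed mass. Only its values on rectangles are written down;
  \<open>exists_transport_plan\<close> turns them into a measure.\<close>

lemma exists_matched_plan:
  assumes D: "h_plan X Y \<mu> \<nu> D"
  obtains \<pi> where "matched D \<pi>"
proof -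
  let ?I = "idx (src D)" and ?J = "idx (tgt D)" and ?E = "cell (src D)" and ?F = "cell (tgt D)"
  have P: "h_partition X (mesh D) (src D)" and R: "h_partition Y (mesh D) (tgt D)"
    and fin: "finite ?I" "finite ?J"
    and w: "\<And>i j. i \<in> ?I \<Longrightarrow> j \<in> ?J \<Longrightarrow> 0 \<le> wt D i j"
    and w1: "\<And>i. i \<in> ?I \<Longrightarrow> (\<Sum>j\<in>?J. wt D i j) = measure \<mu> (?E i)"
    and w2: "\<And>j. j \<in> ?J \<Longrightarrow> (\<Sum>i\<in>?I. wt D i j) = measure \<nu> (?F j)"
    using D by (auto simp: h_plan_def h_partition_def)
  have E: "\<And>i. i \<in> ?I \<Longrightarrow> ?E i \<in> sets \<mu>" and F: "\<And>j. j \<in> ?J \<Longrightarrow> ?F j \<in> sets \<nu>"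
    using P R by (auto intro: partition1_sets partition2_sets)
  have EX: "\<And>i. i \<in> ?I \<Longrightarrow> X \<inter> ?E i = ?E i" and FY: "\<And>j. j \<in> ?J \<Longrightarrow> Y \<inter> ?F j = ?F j"
    using P R by (auto simp: h_partition_def)
  \<comment> \<open>Weights in a null row or column vanish, which agrees with the value 0 that
    division by 0 gives to \<open>q\<close> there.\<close>
  have w0: "wt D i j = 0" if "i \<in> ?I" "j \<in> ?J" "measure \<mu> (?E i) = 0 \<or> measure \<nu> (?F j) = 0" for i j
    using that w1[of i] w2[of j] fin sum_nonneg_eq_0_iff[of ?J "\<lambda>j. wt D i j"]
      sum_nonneg_eq_0_iff[of ?I "\<lambda>i. wt D i j"] w by auto
  have E0: "measure \<mu> (A \<inter> ?E i) = 0" if "i \<in> ?I" "measure \<mu> (?E i) = 0" "A \<in> sets \<mu>" for A i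
    using \<mu>.finite_measure_mono[of "A \<inter> ?E i" "?E i"] E that by (simp add: measure_le_0_iff)
  have F0: "measure \<nu> (B \<inter> ?F j) = 0" if "j \<in> ?J" "measure \<nu> (?F j) = 0" "B \<in> sets \<nu>" for B j
    using \<nu>.finite_measure_mono[of "B \<inter> ?F j" "?F j"] F that by (simp add: measure_le_0_iff)
  define q where "q i j = wt D i j / (measure \<mu> (?E i) * measure \<nu> (?F j))" for i j
  define p where "p A B = (\<Sum>i\<in>?I. \<Sum>j\<in>?J. q i j * measure \<mu> (A \<inter> ?E i) * measure \<nu> (B \<inter> ?F j))" for A B
  have "biadditive \<mu> \<nu> p"
  proof
    fix A B show "0 \<le> p A B" unfolding p_def q_def using w
      by (intro sum_nonneg mult_nonneg_nonneg divide_nonneg_nonneg) auto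
  next
    fix A A' B assume *: "A \<in> sets \<mu>" "A' \<in> sets \<mu>" "A \<inter> A' = {}" "B \<in> sets \<nu>"
    have "measure \<mu> ((A \<union> A') \<inter> ?E i) = measure \<mu> (A \<inter> ?E i) + measure \<mu> (A' \<inter> ?E i)" if "i \<in> ?I" for i
      unfolding Int_Un_distrib2 using * E[OF that] by (intro \<mu>.finite_measure_Union) auto
    then show "p (A \<union> A') B = p A B + p A' B"
      unfolding p_def sum.distrib[symmetric] by (intro sum.cong refl) (simp add: algebra_simps)
  next
    fix A B B' assume *: "A \<in> sets \<mu>" "B \<in> sets \<nu>" "B' \<in> sets \<nu>" "B \<inter> B' = {}"
    have "measure \<nu> ((B \<union> B') \<inter> ?F j) = measure \<nu> (B \<inter> ?F j) + measure \<nu> (B' \<inter> ?F j)" if "j \<in> ?J" for j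
      unfolding Int_Un_distrib2 using * F[OF that] by (intro \<nu>.finite_measure_Union) auto
    then show "p A (B \<union> B') = p A B + p A B'"
      unfolding p_def sum.distrib[symmetric] by (intro sum.cong refl) (simp add: algebra_simps)
  qed
  moreover have "p A Y = measure \<mu> A" if A: "A \<in> sets \<mu>" for A
  proof -
    have "p A Y = (\<Sum>i\<in>?I. \<Sum>j\<in>?J. wt D i j * (measure \<mu> (A \<inter> ?E i) / measure \<mu> (?E i)))"
      unfolding p_def q_def using w0 by (intro sum.cong refl) (auto simp: FY)
    also have "\<dots> = (\<Sum>i\<in>?I. measure \<mu> (A \<inter> ?E i))"
      using E0[OF _ _ A] by (intro sum.cong refl, subst sum_distrib_right[symmetric]) (auto simp: w1)
    finally show ?thesis using sum_cells1[OF P A] by simp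
  qed
  moreover have "p X B = measure \<nu> B" if B: "B \<in> sets \<nu>" for B
  proof -
    have "p X B = (\<Sum>i\<in>?I. \<Sum>j\<in>?J. wt D i j * (measure \<nu> (B \<inter> ?F j) / measure \<nu> (?F j)))"
      unfolding p_def q_def using w0 by (intro sum.cong refl) (auto simp: EX)
    also have "\<dots> = (\<Sum>j\<in>?J. \<Sum>i\<in>?I. wt D i j * (measure \<nu> (B \<inter> ?F j) / measure \<nu> (?F j)))"
      by (rule sum.swap)
    also have "\<dots> = (\<Sum>j\<in>?J. measure \<nu> (B \<inter> ?F j))"
      using F0[OF _ _ B] by (intro sum.cong refl, subst sum_distrib_right[symmetric]) (auto simp: w2)
    finally show ?thesis using sum_cells2[OF R B] by simp
  qed
  ultimately obtain \<pi> where \<pi>: "\<pi> \<in> transport_plans X Y \<mu> \<nu>"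
    "\<And>A B. A \<in> sets \<mu> \<Longrightarrow> B \<in> sets \<nu> \<Longrightarrow> measure \<pi> (A \<times> B) = p A B"
    using exists_transport_plan[OF compact_X \<mu>.prob_space_axioms sets_\<mu> compact_Y \<nu>.prob_space_axioms sets_\<nu>, of p] by blast
  have "p (?E k) (?F l) = wt D k l" if k: "k \<in> ?I" "l \<in> ?J" for k l
  proof -
    have EE: "?E k \<inter> ?E i = (if i = k then ?E k else {})" if "i \<in> ?I" for i
      using P k that by (auto simp: h_partition_def disjoint_family_on_def)
    have FF: "?F l \<inter> ?F j = (if j = l then ?F l else {})" if "j \<in> ?J" for j
      using R k that by (auto simp: h_partition_def disjoint_family_on_def)
    have "p (?E k) (?F l) = (\<Sum>i\<in>?I. \<Sum>j\<in>?J. if i = k then if j = l then wt D k l else 0 else 0)"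
      unfolding p_def q_def using w0 k by (intro sum.cong refl) (auto simp: EE FF)
    also have "\<dots> = (\<Sum>i\<in>?I. if i = k then wt D k l else 0)"
      using k fin by (intro sum.cong refl) auto
    also have "\<dots> = wt D k l" using k fin by simp
    finally show ?thesis .
  qed
  then have "matched D \<pi>" using D \<pi> E F by (simp add: matched_def)
  then show ?thesis by (rule that)
qed

text \<open>The left side is the integral of the step function with value \<open>s i j\<close> on
  the products of cells, and this function lies below \<open>f\<close>. The one-sided form admits
  error terms in \<open>f\<close> that are small only in mean.\<close>

lemma matched_sum_le_integral:
  fixes f :: "'a \<times> 'b \<Rightarrow> real"
  assumes m: "matched D \<pi>" and f: "integrable \<pi> f"
    and le: "\<And>i j x y. i \<in> idx (src D) \<Longrightarrow> j \<in> idx (tgt D) \<Longrightarrow> x \<in> cell (src D) i \<Longrightarrow> y \<in> cell (tgt D) j \<Longrightarrow> s i j \<le> f (x, y)"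
  shows "(\<Sum>i\<in>idx (src D). \<Sum>j\<in>idx (tgt D). wt D i j * s i j) \<le> (LINT z|\<pi>. f z)"
proof -
  let ?I = "idx (src D)" and ?J = "idx (tgt D)" and ?E = "cell (src D)" and ?F = "cell (tgt D)"
  have P: "h_partition X (mesh D) (src D)" and R: "h_partition Y (mesh D) (tgt D)"
    and \<pi>: "\<pi> \<in> transport_plans X Y \<mu> \<nu>"
    and w: "\<And>i j. i \<in> ?I \<Longrightarrow> j \<in> ?J \<Longrightarrow> measure \<pi> (?E i \<times> ?F j) = wt D i j"
    using m by (auto simp: matched_def h_plan_def)
  interpret \<pi>: prob_space \<pi> by (rule plan_prob[OF \<pi>])
  have EF: "?E i \<times> ?F j \<in> sets \<pi>" if "i \<in> ?I" "j \<in> ?J" for i j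
    using that P R by (intro plan_Times[OF \<pi>] partition1_sets partition2_sets)
  have int: "integrable \<pi> (\<lambda>z. s i j * indicator (?E i \<times> ?F j) z)" if "i \<in> ?I" "j \<in> ?J" for i j
    using EF[OF that] by (intro integrable_mult_right integrable_real_indicator) (auto simp: \<pi>.emeasure_eq_measure)
  have "(\<Sum>i\<in>?I. \<Sum>j\<in>?J. wt D i j * s i j) = (\<Sum>i\<in>?I. \<Sum>j\<in>?J. LINT z|\<pi>. s i j * indicator (?E i \<times> ?F j) z)"
    using EF w by (intro sum.cong refl) (simp add: mult.commute)
  also have "\<dots> = (LINT z|\<pi>. (\<Sum>i\<in>?I. \<Sum>j\<in>?J. s i j * indicator (?E i \<times> ?F j) z))"
    using int by (simp add: Bochner_Integration.integral_sum Bochner_Integration.integrable_sum)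
  also have "\<dots> \<le> (LINT z|\<pi>. f z)"
  proof (intro integral_mono Bochner_Integration.integrable_sum int f)
    fix z assume "z \<in> space \<pi>"
    then obtain x y where z: "z = (x, y)" "x \<in> X" "y \<in> Y" by (auto simp: plan_space[OF \<pi>])
    obtain i j where ij: "i \<in> ?I" "x \<in> ?E i" "j \<in> ?J" "y \<in> ?F j"
      using P R z by (auto simp: h_partition_def)
    have "(\<Sum>i\<in>?I. \<Sum>j\<in>?J. s i j * indicator (?E i \<times> ?F j) z)
        = (\<Sum>i\<in>?I. if x \<in> ?E i then \<Sum>j\<in>?J. if y \<in> ?F j then s i j else 0 else 0)"
      by (intro sum.cong refl) (auto simp: z indicator_def intro!: sum.cong sum.neutral)
    also have "\<dots> = s i j" using ij P R by (simp add: h_partition_sum_delta)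
    finally show "(\<Sum>i\<in>?I. \<Sum>j\<in>?J. s i j * indicator (?E i \<times> ?F j) z) \<le> f z"
      using le ij z by simp
  qed
  finally show ?thesis .
qed

lemma matched_abs_diff_integral_le:
  fixes f :: "'a \<times> 'b \<Rightarrow> real"
  assumes m: "matched D \<pi>" and f: "integrable \<pi> f"
    and le: "\<And>i j x y. i \<in> idx (src D) \<Longrightarrow> j \<in> idx (tgt D) \<Longrightarrow> x \<in> cell (src D) i \<Longrightarrow> y \<in> cell (tgt D) j
      \<Longrightarrow> \<bar>s i j - f (x, y)\<bar> \<le> e"
  shows "\<bar>(\<Sum>i\<in>idx (src D). \<Sum>j\<in>idx (tgt D). wt D i j * s i j) - (LINT z|\<pi>. f z)\<bar> \<le> e"
proof -
  interpret \<pi>: prob_space \<pi> using m plan_prob by (auto simp: matched_def)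
  have "(\<Sum>i\<in>idx (src D). \<Sum>j\<in>idx (tgt D). wt D i j * s i j) \<le> (LINT z|\<pi>. f z + e)"
    using f le by (intro matched_sum_le_integral[OF m]) (fastforce simp: abs_le_iff)+
  moreover have "(\<Sum>i\<in>idx (src D). \<Sum>j\<in>idx (tgt D). wt D i j * (- s i j)) \<le> (LINT z|\<pi>. - f z + e)"
    using f le by (intro matched_sum_le_integral[OF m]) (fastforce simp: abs_le_iff)+
  ultimately show ?thesis using f by (simp add: sum_negf \<pi>.prob_space abs_le_iff)
qed

lemma integrable_cost:
  assumes "\<pi> \<in> transport_plans X Y \<mu> \<nu>"
  shows "integrable \<pi> c"
proof -
  interpret \<pi>: prob_space \<pi> by (rule plan_prob[OF assms])
  have "bounded (c ` (X \<times> Y))"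
    using compact_continuous_image[OF continuous_cost compact_Times[OF compact_X compact_Y]] by (rule compact_imp_bounded)
  then obtain b where "\<And>z. z \<in> X \<times> Y \<Longrightarrow> norm (c z) \<le> b" by (auto simp: bounded_iff)
  moreover have "c \<in> borel_measurable \<pi>"
    using borel_measurable_continuous_on_restrict[OF continuous_cost] assms
    by (simp add: transport_plans_def cong: measurable_cong_sets)
  ultimately show ?thesis
    by (intro \<pi>.integrable_const_bound[of _ b]) (auto simp: plan_space[OF assms])
qed

text \<open>Uniform continuity of \<open>c\<close> makes \<open>\<delta>\<close> independent of
  plans, partitions and tags, so the same \<open>\<delta>\<close> serves for all
  competitors.\<close>

lemma cost_matched:
  assumes "0 < e"
  obtains \<delta> where "0 < \<delta>"
    "\<And>D \<pi>. matched D \<pi> \<Longrightarrow> mesh D < \<delta> \<Longrightarrow> \<bar>K_cost c (plan_measure X Y D) - K_cost c \<pi>\<bar> \<le> e"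
proof -
  have "uniformly_continuous_on (X \<times> Y) c" using continuous_cost compact_Times[OF compact_X compact_Y] by (rule compact_uniformly_continuous)
  then obtain d where d: "0 < d" "\<And>z z'. z \<in> X \<times> Y \<Longrightarrow> z' \<in> X \<times> Y \<Longrightarrow> dist z z' < d \<Longrightarrow> dist (c z) (c z') < e"
    using \<open>0 < e\<close> unfolding uniformly_continuous_on_def by metis
  \<comment> \<open>Half of \<open>d\<close>, because the deviations in the two coordinates add
    up.\<close>
  have "\<bar>K_cost c (plan_measure X Y D) - K_cost c \<pi>\<bar> \<le> e" if m: "matched D \<pi>" and h: "mesh D < d / 2" for D \<pi>
  proof -
    have \<pi>: "\<pi> \<in> transport_plans X Y \<mu> \<nu>" and D: "h_plan X Y \<mu> \<nu> D"
      and P: "h_partition X (mesh D) (src D)" and R: "h_partition Y (mesh D) (tgt D)"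
      using m by (auto simp: matched_def h_plan_def)
    show ?thesis unfolding K_cost_plan_measure[OF D continuous_cost] unfolding K_cost_def
    proof (rule matched_abs_diff_integral_le[OF m integrable_cost[OF \<pi>]])
      fix i j x y assume ij: "i \<in> idx (src D)" "j \<in> idx (tgt D)" "x \<in> cell (src D) i" "y \<in> cell (tgt D) j"
      let ?x = "tag (src D) i" and ?y = "tag (tgt D) j"
      have t: "?x \<in> cell (src D) i" "?y \<in> cell (tgt D) j" using ij P R by (auto simp: h_partition_def)
      have "dist (?x, ?y) (x, y) \<le> dist ?x x + dist ?y y"
        unfolding dist_Pair_Pair by (rule sqrt_sum_squares_le_sum) auto
      also have "\<dots> < d"
        using h_partition_dist_le[OF compact_X P ij(1) t(1) ij(3)] h_partition_dist_le[OF compact_Y R ij(2) t(2) ij(4)] h by simp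
      finally have "dist (c (?x, ?y)) (c (x, y)) < e"
        using ij t P R by (intro d(2)) (auto simp: h_partition_def)
      then show "\<bar>c (?x, ?y) - c (x, y)\<bar> \<le> e" by (simp add: dist_real_def)
    qed
  qed
  then show ?thesis using d(1) that[of "d / 2"] by simp
qed

end

section \<open>Cluster points of transport plans\<close>

lemma compact_cube: "compact {f :: 'i \<Rightarrow> real. \<forall>i. f i \<in> {0..1}}"
proof -
  have "compactin (product_topology (\<lambda>i. euclidean) UNIV) (PiE UNIV (\<lambda>i::'i. {0..1::real}))"
    unfolding compactin_PiE by simp
  then have "compact (PiE UNIV (\<lambda>i::'i. {0..1::real}))"
    by (simp only: euclidean_product_topology compactin_euclidean_iff)
  then show ?thesis by (simp add: PiE_UNIV_domain Pi_def)
qed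

text \<open>The cube may have uncountably many coordinates, so compactness is used through finer
  filters instead of subsequences. \<open>F\<close> joins \<open>F0\<close> with the preimages of
  the neighbourhoods of a cluster point.\<close>

lemma cluster_filter:
  fixes f :: "'n \<Rightarrow> 'b::topological_space"
  assumes "compact K" "\<And>n. f n \<in> K" "F0 \<noteq> bot"
  obtains F l where "F \<le> F0" "F \<noteq> bot" "(f \<longlongrightarrow> l) F"
proof -
  have "filtermap f F0 \<noteq> bot" using assms(3) by (simp add: filtermap_bot_iff)
  moreover have "eventually (\<lambda>x. x \<in> K) (filtermap f F0)" using assms(2) by (simp add: eventually_filtermap)
  ultimately obtain l where l: "inf (nhds l) (filtermap f F0) \<noteq> bot"
    using assms(1) unfolding compact_filter by blast
  define F where "F = inf (filtercomap f (nhds l)) F0"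
  have "F \<noteq> bot"
  proof
    assume "F = bot"
    then have "eventually (\<lambda>_. False) F" by simp
    then obtain Q R where QR: "eventually Q (filtercomap f (nhds l))" "eventually R F0" "\<And>n. Q n \<Longrightarrow> R n \<Longrightarrow> False"
      unfolding F_def eventually_inf by blast
    obtain S where S: "eventually S (nhds l)" "\<And>n. S (f n) \<Longrightarrow> Q n"
      using QR(1) by (auto simp: eventually_filtercomap)
    have "eventually (\<lambda>y. \<not> S y) (filtermap f F0)"
      unfolding eventually_filtermap using QR(2) by eventually_elim (use S(2) QR(3) in blast)
    then have "eventually (\<lambda>_. False) (inf (nhds l) (filtermap f F0))"
      using S(1) unfolding eventually_inf by blast
    with l show False by (simp add: eventually_False)
  qed
  moreover have "(f \<longlongrightarrow> l) F" unfolding F_def by (rule filterlim_mono[OF filterlim_filtercomap]) auto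
  ultimately show ?thesis using that[of F l] by (simp add: F_def)
qed

context compact_OT
begin

text \<open>Additivity and the marginal conditions each relate finitely many coordinates, so the
  limit in the cube keeps them and extends to a plan.\<close>

lemma plans_cluster:
  assumes \<pi>: "\<And>n. \<pi> n \<in> transport_plans X Y \<mu> \<nu>" and F0: "F0 \<noteq> bot"
  obtains F \<rho> where "F \<le> F0" "F \<noteq> bot" "\<rho> \<in> transport_plans X Y \<mu> \<nu>"
    "\<And>A B. A \<in> sets \<mu> \<Longrightarrow> B \<in> sets \<nu> \<Longrightarrow> ((\<lambda>n. measure (\<pi> n) (A \<times> B)) \<longlongrightarrow> measure \<rho> (A \<times> B)) F"
proof -
  \<comment> \<open>The coordinates are all pairs of sets; where \<open>A \<times> B\<close> is not
    measurable, \<open>measure\<close> is 0 and still lies in the unit interval.\<close>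
  have cube: "(\<lambda>(A, B). measure (\<pi> n) (A \<times> B)) \<in> {f. \<forall>i. f i \<in> {0..1}}" for n
    using prob_space.prob_le_1[OF plan_prob[OF \<pi>]] by auto
  obtain F g where F: "F \<le> F0" "F \<noteq> bot" and lim: "((\<lambda>n. \<lambda>(A, B). measure (\<pi> n) (A \<times> B)) \<longlongrightarrow> g) F"
    by (rule cluster_filter[OF compact_cube cube F0])
  define p where "p A B = g (A, B)" for A B
  have p: "((\<lambda>n. measure (\<pi> n) (A \<times> B)) \<longlongrightarrow> p A B) F" for A B
    using continuous_on_tendsto_compose[OF continuous_on_product_coordinates[of "(A, B)"] lim] by (simp add: p_def)
  have ba: "biadditive \<mu> \<nu> (\<lambda>A B. measure (\<pi> n) (A \<times> B))" for n by (rule plan_biadditive[OF \<pi>])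
  have "biadditive \<mu> \<nu> p"
  proof
    fix A B show "0 \<le> p A B" by (rule tendsto_lowerbound[OF p _ F(2)]) simp
  next
    fix A A' B assume "A \<in> sets \<mu>" "A' \<in> sets \<mu>" "A \<inter> A' = {}" "B \<in> sets \<nu>"
    then have "((\<lambda>n. measure (\<pi> n) ((A \<union> A') \<times> B)) \<longlongrightarrow> p A B + p A' B) F"
      using tendsto_add[OF p[of A B] p[of A' B]] by (simp add: biadditive.add1[OF ba])
    then show "p (A \<union> A') B = p A B + p A' B" using tendsto_unique[OF F(2) p] by blast
  next
    fix A B B' assume "A \<in> sets \<mu>" "B \<in> sets \<nu>" "B' \<in> sets \<nu>" "B \<inter> B' = {}"
    then have "((\<lambda>n. measure (\<pi> n) (A \<times> (B \<union> B'))) \<longlongrightarrow> p A B + p A B') F"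
      using tendsto_add[OF p[of A B] p[of A B']] by (simp add: biadditive.add2[OF ba])
    then show "p A (B \<union> B') = p A B + p A B'" using tendsto_unique[OF F(2) p] by blast
  qed
  moreover have "p A Y = measure \<mu> A" if "A \<in> sets \<mu>" for A
    using tendsto_unique[OF F(2) p, of A Y "measure \<mu> A"] plan_marginal1[OF \<pi> that] by simp
  moreover have "p X B = measure \<nu> B" if "B \<in> sets \<nu>" for B
    using tendsto_unique[OF F(2) p, of X B "measure \<nu> B"] plan_marginal2[OF \<pi> that] by simp
  ultimately obtain \<rho> where \<rho>: "\<rho> \<in> transport_plans X Y \<mu> \<nu>"
    "\<And>A B. A \<in> sets \<mu> \<Longrightarrow> B \<in> sets \<nu> \<Longrightarrow> measure \<rho> (A \<times> B) = p A B"
    using exists_transport_plan[OF compact_X \<mu>.prob_space_axioms sets_\<mu> compact_Y \<nu>.prob_space_axioms sets_\<nu>, of p] by blast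
  show ?thesis using that[OF F \<rho>(1)] p \<rho>(2) by simp
qed

lemma exists_small_partitions:
  assumes "0 < h"
  obtains D :: "('a, 'b) discrete_plan" where "mesh D = h" "h_partition X h (src D)" "h_partition Y h (tgt D)"
proof -
  obtain P where "h_partition X h P"
    using exists_h_partition[OF compact_X \<mu>.finite_measure_axioms sets_\<mu> assms] by metis
  moreover obtain R where "h_partition Y h R"
    using exists_h_partition[OF compact_Y \<nu>.finite_measure_axioms sets_\<nu> assms] by metis
  ultimately show ?thesis using that[of "\<lparr>mesh = h, src = P, tgt = R, wt = (\<lambda>_ _. 0)\<rparr>"] by simp
qed

text \<open>For one fixed fine pair of partitions, the cost of every plan is within
  \<open>e / 3\<close> of a finite linear combination of cell masses, and these masses converge by
  assumption.\<close>

lemma tendsto_K_cost: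
  assumes \<pi>: "\<And>n. \<pi> n \<in> transport_plans X Y \<mu> \<nu>" and \<rho>: "\<rho> \<in> transport_plans X Y \<mu> \<nu>"
    and lim: "\<And>A B. A \<in> sets \<mu> \<Longrightarrow> B \<in> sets \<nu> \<Longrightarrow> ((\<lambda>n. measure (\<pi> n) (A \<times> B)) \<longlongrightarrow> measure \<rho> (A \<times> B)) F"
  shows "((\<lambda>n. K_cost c (\<pi> n)) \<longlongrightarrow> K_cost c \<rho>) F"
proof (rule tendstoI)
  fix e :: real assume "0 < e"
  then obtain \<delta> where \<delta>: "0 < \<delta>"
    "\<And>D \<pi>. matched D \<pi> \<Longrightarrow> mesh D < \<delta> \<Longrightarrow> \<bar>K_cost c (plan_measure X Y D) - K_cost c \<pi>\<bar> \<le> e / 3"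
    using cost_matched[of "e / 3"] by auto
  obtain D :: "('a, 'b) discrete_plan" where D: "mesh D = \<delta> / 2" "h_partition X (mesh D) (src D)" "h_partition Y (mesh D) (tgt D)"
    using exists_small_partitions[of "\<delta> / 2"] \<delta>(1) by (metis half_gt_zero)
  define E where "E \<pi> = D\<lparr>wt := \<lambda>i j. measure \<pi> (cell (src D) i \<times> cell (tgt D) j)\<rparr>" for \<pi>
  have m: "matched (E \<pi>) \<pi>" if "\<pi> \<in> transport_plans X Y \<mu> \<nu>" for \<pi>
    unfolding E_def by (rule matched_discretization[OF D(2,3) that])
  have close: "\<bar>K_cost c (plan_measure X Y (E \<pi>)) - K_cost c \<pi>\<bar> \<le> e / 3" if "\<pi> \<in> transport_plans X Y \<mu> \<nu>" for \<pi>
    by (rule \<delta>(2)[OF m[OF that]]) (use D(1) \<delta>(1) in \<open>simp add: E_def\<close>)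
  have K: "K_cost c (plan_measure X Y (E \<pi>)) =
      (\<Sum>i\<in>idx (src D). \<Sum>j\<in>idx (tgt D). measure \<pi> (cell (src D) i \<times> cell (tgt D) j) * c (tag (src D) i, tag (tgt D) j))"
    if "\<pi> \<in> transport_plans X Y \<mu> \<nu>" for \<pi>
    using K_cost_plan_measure[OF _ continuous_cost, of \<mu> \<nu> "E \<pi>"] m[OF that] by (simp add: matched_def E_def)
  have "((\<lambda>n. K_cost c (plan_measure X Y (E (\<pi> n)))) \<longlongrightarrow> K_cost c (plan_measure X Y (E \<rho>))) F"
    unfolding K[OF \<pi>] K[OF \<rho>]
    by (intro tendsto_sum tendsto_mult tendsto_const lim partition1_sets[OF D(2)] partition2_sets[OF D(3)])
  then have "\<forall>\<^sub>F n in F. dist (K_cost c (plan_measure X Y (E (\<pi> n)))) (K_cost c (plan_measure X Y (E \<rho>))) < e / 3"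
    by (rule tendstoD) (use \<open>0 < e\<close> in simp)
  then show "\<forall>\<^sub>F n in F. dist (K_cost c (\<pi> n)) (K_cost c \<rho>) < e"
  proof eventually_elim
    case (elim n)
    then show ?case using close[OF \<pi>[of n]] close[OF \<rho>] unfolding dist_real_def by linarith
  qed
qed

lemma optimal_cost_le: "optimal_plan X Y \<mu> \<nu> c \<pi> \<Longrightarrow> \<rho> \<in> transport_plans X Y \<mu> \<nu> \<Longrightarrow> K_cost c \<pi> \<le> K_cost c \<rho>"
  by (simp add: optimal_plan_def)

lemma
  assumes T: "T \<in> transport_maps X Y \<mu> \<nu>"
  shows transport_map_measurable: "T \<in> measurable \<mu> \<nu>"
    and induced_plan_in: "induced_plan X Y \<mu> T \<in> transport_plans X Y \<mu> \<nu>"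
    and measure_induced_plan: "\<And>A B. A \<in> sets \<mu> \<Longrightarrow> B \<in> sets \<nu> \<Longrightarrow>
      measure (induced_plan X Y \<mu> T) (A \<times> B) = measure \<mu> (A \<inter> (T -` B \<inter> X))"
    and K_cost_induced_plan: "K_cost c (induced_plan X Y \<mu> T) = (LINT x|\<mu>. c (x, T x))"
proof -
  have "T \<in> measurable (restrict_space borel X) (restrict_space borel Y)"
    using T by (simp add: transport_maps_def)
  then show T1[measurable]: "T \<in> measurable \<mu> \<nu>" using sets_\<mu> sets_\<nu> by (simp cong: measurable_cong_sets)
  have T2: "distr \<mu> \<nu> T = \<nu>" using T sets_\<nu> by (simp add: transport_maps_def cong: distr_cong)
  have "(\<lambda>x. (x, T x)) \<in> measurable \<mu> (\<mu> \<Otimes>\<^sub>M \<nu>)" by measurable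
  then have g: "(\<lambda>x. (x, T x)) \<in> measurable \<mu> (restrict_space borel (X \<times> Y))"
    by (simp cong: measurable_cong_sets add: sets_pair)
  have fs: "fst \<in> measurable (restrict_space borel (X \<times> Y)) (restrict_space borel X)"
      "snd \<in> measurable (restrict_space borel (X \<times> Y)) (restrict_space borel Y)"
    using measurable_fst[of \<mu> \<nu>] measurable_snd[of \<mu> \<nu>] sets_\<mu> sets_\<nu> sets_pair
    by (simp_all cong: measurable_cong_sets)
  have "distr (induced_plan X Y \<mu> T) (restrict_space borel X) fst = distr \<mu> \<mu> (\<lambda>x. x)"
    unfolding induced_plan_def distr_distr[OF fs(1) g] by (rule distr_cong) (auto simp: sets_\<mu>)
  moreover have "distr (induced_plan X Y \<mu> T) (restrict_space borel Y) snd = distr \<mu> \<nu> T"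
    unfolding induced_plan_def distr_distr[OF fs(2) g] by (rule distr_cong) (auto simp: sets_\<nu>)
  moreover have "prob_space (induced_plan X Y \<mu> T)"
    unfolding induced_plan_def by (rule \<mu>.prob_space_distr[OF g])
  ultimately show "induced_plan X Y \<mu> T \<in> transport_plans X Y \<mu> \<nu>"
    using T2 by (simp add: transport_plans_def distr_id2) (simp add: induced_plan_def)
  show "measure (induced_plan X Y \<mu> T) (A \<times> B) = measure \<mu> (A \<inter> (T -` B \<inter> X))"
    if "A \<in> sets \<mu>" "B \<in> sets \<nu>" for A B
  proof -
    have "A \<times> B \<in> sets (restrict_space borel (X \<times> Y))" using that by (simp add: sets_pair)
    then have "measure (induced_plan X Y \<mu> T) (A \<times> B) = measure \<mu> ((\<lambda>x. (x, T x)) -` (A \<times> B) \<inter> space \<mu>)"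
      unfolding induced_plan_def by (rule measure_distr[OF g])
    also have "(\<lambda>x. (x, T x)) -` (A \<times> B) \<inter> space \<mu> = A \<inter> (T -` B \<inter> X)" by (auto simp: space_\<mu>)
    finally show ?thesis .
  qed
  show "K_cost c (induced_plan X Y \<mu> T) = (LINT x|\<mu>. c (x, T x))"
    unfolding K_cost_def induced_plan_def
    by (rule integral_distr[OF g borel_measurable_continuous_on_restrict[OF continuous_cost]])
qed

text \<open>Continuity gives measurability for the Borel sets of \<open>Y \<times> Y\<close>; these
  form the product sigma-algebra because \<open>Y\<close> is compact.\<close>

lemma dist_Y_measurable: "(\<lambda>z. dist (fst z) (snd z)) \<in> borel_measurable (\<nu> \<Otimes>\<^sub>M \<nu>)"
proof -
  have "continuous_on (Y \<times> Y) (\<lambda>z. dist (fst z) (snd z))" by (intro continuous_intros)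
  then have "(\<lambda>z. dist (fst z) (snd z)) \<in> borel_measurable (restrict_space borel (Y \<times> Y))"
    by (rule borel_measurable_continuous_on_restrict)
  moreover have "sets (restrict_space borel (Y \<times> Y)) = sets (\<nu> \<Otimes>\<^sub>M \<nu>)"
    using sets_pair_restrict_borel[OF compact_Y compact_Y] sets_pair_measure_cong[OF sets_\<nu> sets_\<nu>] by simp
  ultimately show ?thesis by (simp cong: measurable_cong_sets)
qed

lemma dist_measurable:
  assumes "f \<in> measurable M \<nu>" "g \<in> measurable M \<nu>"
  shows "(\<lambda>x. dist (f x) (g x)) \<in> borel_measurable M"
  using measurable_compose[OF measurable_Pair[OF assms] dist_Y_measurable] by simp

lemma dist_Y_bounded: "\<exists>b>0. \<forall>y\<in>Y. \<forall>z\<in>Y. dist y z \<le> b"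
proof -
  obtain e where "\<And>y z. y \<in> Y \<Longrightarrow> z \<in> Y \<Longrightarrow> dist y z \<le> e"
    using compact_imp_bounded[OF compact_Y] unfolding bounded_two_points by blast
  then show ?thesis by (intro exI[of _ "max e 1"]) (simp add: le_max_iff_disj)
qed

end

section \<open>Minimizing plans concentrate on the graph of the optimal map\<close>

locale optimal_transport_map = compact_OT +
  fixes T :: "'a \<Rightarrow> 'b"
  assumes su: "strong_uniqueness X Y \<mu> \<nu> c" and opt: "optimal_map X Y \<mu> \<nu> c T"
begin

abbreviation \<pi>star :: "('a \<times> 'b) measure" where "\<pi>star \<equiv> induced_plan X Y \<mu> T"

lemma T_map: "T \<in> transport_maps X Y \<mu> \<nu>" using opt by (simp add: optimal_map_def)

lemmas T_measurable = transport_map_measurable[OF T_map] and \<pi>star_plan = induced_plan_in[OF T_map]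

lemma T_in: "x \<in> X \<Longrightarrow> T x \<in> Y"
  using measurable_space[OF T_measurable] by (simp add: space_\<mu> space_\<nu>)

text \<open>\<open>opt\<close> compares \<open>T\<close> with maps only. By (SU) the optimal plan is
  itself induced by a map, so this comparison already reaches the minimum over plans.\<close>

lemma \<pi>star_optimal: "optimal_plan X Y \<mu> \<nu> c \<pi>star"
proof -
  obtain \<pi> S where \<pi>: "optimal_plan X Y \<mu> \<nu> c \<pi>" and S: "S \<in> transport_maps X Y \<mu> \<nu>" "induced_plan X Y \<mu> S = \<pi>"
    using su by (auto simp: strong_uniqueness_def)
  have "K_cost c \<pi>star \<le> K_cost c \<pi>"
    using opt S K_cost_induced_plan[OF T_map] K_cost_induced_plan[OF S(1)] by (auto simp: optimal_map_def)
  then show ?thesis using \<pi> \<pi>star_plan unfolding optimal_plan_def by force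
qed

lemma optimal_plan_unique: "optimal_plan X Y \<mu> \<nu> c \<pi> \<Longrightarrow> \<pi> = \<pi>star"
  using su \<pi>star_optimal by (auto simp: strong_uniqueness_def)

lemma integrable_dist_map:
  assumes \<pi>: "\<pi> \<in> transport_plans X Y \<mu> \<nu>"
  shows "integrable \<pi> (\<lambda>z. dist (snd z) (T (fst z)))"
proof -
  interpret \<pi>: prob_space \<pi> by (rule plan_prob[OF \<pi>])
  obtain b where "0 < b" "\<And>y z. y \<in> Y \<Longrightarrow> z \<in> Y \<Longrightarrow> dist y z \<le> b" using dist_Y_bounded by auto
  then show ?thesis using T_in
    by (intro \<pi>.integrable_const_bound[of _ b] dist_measurable plan_snd[OF \<pi>]
      measurable_compose[OF plan_fst[OF \<pi>] T_measurable]) (auto simp: plan_space[OF \<pi>])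
qed

text \<open>Otherwise a cluster plan along the bad indices is optimal and therefore equals
  \<open>\<pi>star\<close>. The integrand may be discontinuous, but up to \<open>e / 2\<close> it is
  controlled by the mass outside finitely many measurable rectangles that cover the graph of
  \<open>T\<close>.\<close>

lemma dist_map_tendsto_0:
  assumes \<pi>: "\<And>n. \<pi> n \<in> transport_plans X Y \<mu> \<nu>"
    and near: "\<And>e. 0 < e \<Longrightarrow> \<forall>\<^sub>F n in sequentially. K_cost c (\<pi> n) \<le> K_cost c \<pi>star + e"
  shows "(\<lambda>n. LINT z|\<pi> n. dist (snd z) (T (fst z))) \<longlonglongrightarrow> 0" (is "?I \<longlonglongrightarrow> 0")
proof (rule ccontr)
  assume "\<not> ?I \<longlonglongrightarrow> 0"
  then obtain e where e: "0 < e" "\<not> (\<forall>\<^sub>F n in sequentially. dist (?I n) 0 < e)"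
    unfolding tendsto_iff by blast
  \<comment> \<open>The tails of the sequence, restricted to the indices whose integral is at least
    \<open>e\<close>.\<close>
  define F0 where "F0 = inf sequentially (principal {n. \<not> ?I n < e})"
  have I0: "0 \<le> ?I n" for n by (intro Bochner_Integration.integral_nonneg) auto
  have "F0 \<noteq> bot"
  proof
    assume "F0 = bot"
    then have "eventually (\<lambda>_. False) F0" by simp
    then have "\<forall>\<^sub>F n in sequentially. ?I n < e" by (simp add: F0_def eventually_inf_principal)
    then show False using e(2) I0 by (simp add: dist_real_def)
  qed
  then obtain F \<rho> where F: "F \<le> F0" "F \<noteq> bot" and \<rho>: "\<rho> \<in> transport_plans X Y \<mu> \<nu>"
    and lim: "\<And>A B. A \<in> sets \<mu> \<Longrightarrow> B \<in> sets \<nu> \<Longrightarrow> ((\<lambda>n. measure (\<pi> n) (A \<times> B)) \<longlongrightarrow> measure \<rho> (A \<times> B)) F"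
    using plans_cluster[where \<pi>=\<pi> and ?F0.0=F0, OF \<pi>] by metis
  have Fseq: "F \<le> sequentially" using F(1) by (simp add: F0_def)
  have large: "\<forall>\<^sub>F n in F. \<not> ?I n < e"
    by (rule filter_leD[OF F(1)]) (simp add: F0_def eventually_inf_principal)
  have "K_cost c \<rho> \<le> K_cost c \<pi>star"
  proof (rule field_le_epsilon)
    fix e' :: real assume "0 < e'"
    show "K_cost c \<rho> \<le> K_cost c \<pi>star + e'"
      by (rule tendsto_upperbound[OF tendsto_K_cost[OF \<pi> \<rho> lim] filter_leD[OF Fseq near[OF \<open>0 < e'\<close>]] F(2)])
  qed
  then have "optimal_plan X Y \<mu> \<nu> c \<rho>"
    using \<rho> \<pi>star_optimal by (force simp: optimal_plan_def)
  then have \<rho>_eq: "\<rho> = \<pi>star" by (rule optimal_plan_unique)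
  obtain b where b: "0 < b" "\<And>y z. y \<in> Y \<Longrightarrow> z \<in> Y \<Longrightarrow> dist y z \<le> b" using dist_Y_bounded by auto
  obtain R where R: "h_partition Y (e / 2) R"
    using exists_h_partition[OF compact_Y \<nu>.finite_measure_axioms sets_\<nu>, of "e / 2"] e(1) by (metis half_gt_zero)
  have finR: "finite (idx R)" and disjR: "disjoint_family_on (cell R) (idx R)" and UR: "(\<Union>j\<in>idx R. cell R j) = Y"
    using R by (auto simp: h_partition_def)
  \<comment> \<open>The union of the rectangles \<open>A j \<times> cell R j\<close> consists of the
    pairs for which \<open>T x\<close> and \<open>y\<close> share a cell. The sets
    \<open>A j\<close> are merely measurable, which is why convergence on all measurable rectangles
    is used.\<close>
  define A where "A j = T -` cell R j \<inter> X" for j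
  have A: "A j \<in> sets \<mu>" if "j \<in> idx R" for j
    using measurable_sets[OF T_measurable partition2_sets[OF R that]] by (simp add: A_def space_\<mu>)
  \<comment> \<open>Within a common cell the distance is at most \<open>e / 2\<close>, elsewhere at
    most \<open>b\<close>.\<close>
  have bound: "?I n \<le> e / 2 + b * (1 - (\<Sum>j\<in>idx R. measure (\<pi> n) (A j \<times> cell R j)))" for n
  proof -
    interpret P: prob_space "\<pi> n" by (rule plan_prob[OF \<pi>])
    have mt: "A j \<times> cell R j \<in> sets (\<pi> n)" if "j \<in> idx R" for j
      by (intro plan_Times[OF \<pi>] A partition2_sets[OF R] that)
    have int: "integrable (\<pi> n) (\<lambda>z. \<Sum>j\<in>idx R. indicator (A j \<times> cell R j) z :: real)"
      using mt by (intro Bochner_Integration.integrable_sum integrable_real_indicator) (auto simp: P.emeasure_eq_measure)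
    have "?I n \<le> (LINT z|\<pi> n. e / 2 + b * (1 - (\<Sum>j\<in>idx R. indicator (A j \<times> cell R j) z)))"
    proof (rule integral_mono[OF integrable_dist_map[OF \<pi>]])
      show "integrable (\<pi> n) (\<lambda>z. e / 2 + b * (1 - (\<Sum>j\<in>idx R. indicator (A j \<times> cell R j) z)))"
        using int by simp
      fix z assume "z \<in> space (\<pi> n)"
      then obtain x y where z: "z = (x, y)" "x \<in> X" "y \<in> Y" by (auto simp: plan_space[OF \<pi>])
      obtain k where k: "k \<in> idx R" "T x \<in> cell R k" using UR T_in[OF z(2)] by blast
      have "(\<Sum>j\<in>idx R. indicator (A j \<times> cell R j) z) =
          (\<Sum>j\<in>idx R. if T x \<in> cell R j then indicator (cell R j) y else (0::real))"
        by (intro sum.cong refl) (auto simp: A_def z indicator_def)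
      also have "\<dots> = indicator (cell R k) y" using h_partition_sum_delta[OF R k] .
      finally have eq: "(\<Sum>j\<in>idx R. indicator (A j \<times> cell R j) z) = (indicator (cell R k) y :: real)" .
      show "dist (snd z) (T (fst z)) \<le> e / 2 + b * (1 - (\<Sum>j\<in>idx R. indicator (A j \<times> cell R j) z))"
        unfolding eq using h_partition_dist_le[OF compact_Y R k(1) _ k(2), of y] b(2)[OF z(3) T_in[OF z(2)]] e(1)
        by (cases "y \<in> cell R k") (auto simp: z)
    qed
    also have "\<dots> = e / 2 + b * (1 - (\<Sum>j\<in>idx R. measure (\<pi> n) (A j \<times> cell R j)))"
    proof -
      have "(LINT z|\<pi> n. (\<Sum>j\<in>idx R. indicator (A j \<times> cell R j) z)) = (\<Sum>j\<in>idx R. measure (\<pi> n) (A j \<times> cell R j))"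
        using mt by (subst Bochner_Integration.integral_sum) (auto simp: P.emeasure_eq_measure)
      then show ?thesis using int by (simp add: P.prob_space)
    qed
    finally show ?thesis .
  qed
  \<comment> \<open>The rectangles cover the graph of \<open>T\<close>, so they carry the full mass
    of the induced plan.\<close>
  have "(\<Sum>j\<in>idx R. measure \<rho> (A j \<times> cell R j)) = (\<Sum>j\<in>idx R. measure \<mu> (A j))"
    using A partition2_sets[OF R] by (intro sum.cong refl) (simp add: \<rho>_eq measure_induced_plan[OF T_map] A_def)
  also have "\<dots> = measure \<mu> (\<Union>j\<in>idx R. A j)"
    using A finR disjR by (intro \<mu>.finite_measure_finite_Union[symmetric]) (auto simp: disjoint_family_on_def A_def)
  also have "(\<Union>j\<in>idx R. A j) = X" using UR T_in by (auto simp: A_def)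
  finally have "(\<Sum>j\<in>idx R. measure \<rho> (A j \<times> cell R j)) = 1" using \<mu>.prob_space by (simp add: space_\<mu>)
  moreover have "((\<lambda>n. e / 2 + b * (1 - (\<Sum>j\<in>idx R. measure (\<pi> n) (A j \<times> cell R j)))) \<longlongrightarrow>
      e / 2 + b * (1 - (\<Sum>j\<in>idx R. measure \<rho> (A j \<times> cell R j)))) F"
    by (intro tendsto_intros lim A partition2_sets[OF R])
  ultimately have "((\<lambda>n. e / 2 + b * (1 - (\<Sum>j\<in>idx R. measure (\<pi> n) (A j \<times> cell R j)))) \<longlongrightarrow> e / 2) F" by simp
  then have "\<forall>\<^sub>F n in F. e / 2 + b * (1 - (\<Sum>j\<in>idx R. measure (\<pi> n) (A j \<times> cell R j))) < e"
    by (rule order_tendstoD(2)) (use e(1) in simp)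
  with large have "\<forall>\<^sub>F n in F. False"
  proof eventually_elim
    case (elim n)
    then show ?case using bound[of n] by linarith
  qed
  then show False using F(2) by (simp add: eventually_False)
qed

end

section \<open>Projection maps and changes of tags\<close>

definition cell_index :: "'a tagged_partition \<Rightarrow> 'a \<Rightarrow> nat"
  where "cell_index P x = (THE i. i \<in> idx P \<and> x \<in> cell P i)"

lemma cell_index_eq:
  assumes "h_partition Z h P" "i \<in> idx P" "x \<in> cell P i"
  shows "cell_index P x = i"
  unfolding cell_index_def using assms by (intro the_equality) (auto simp: h_partition_def disjoint_family_on_def)

lemma cell_index:
  assumes "h_partition Z h P" "x \<in> Z"
  shows "cell_index P x \<in> idx P" "x \<in> cell P (cell_index P x)"
proof -
  obtain i where "i \<in> idx P" "x \<in> cell P i" using assms by (auto simp: h_partition_def)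
  then show "cell_index P x \<in> idx P" "x \<in> cell P (cell_index P x)"
    using cell_index_eq[OF assms(1)] by auto
qed

context compact_OT
begin

lemma Y_nonempty: "Y \<noteq> {}" using \<nu>.not_empty by (simp add: space_\<nu>)

lemma piecewise_constant_measurable:
  assumes P: "h_partition X h P" and g: "\<And>i. i \<in> idx P \<Longrightarrow> g i \<in> Y"
  shows "(\<lambda>x. g (cell_index P x)) \<in> measurable \<mu> \<nu>"
proof (rule measurable_compose[where N="count_space (idx P)"])
  have "cell_index P -` {i} \<inter> space \<mu> = cell P i" if "i \<in> idx P" for i
    using cell_index[OF P] cell_index_eq[OF P that] P that by (auto simp: space_\<mu> h_partition_def)
  then show "cell_index P \<in> measurable \<mu> (count_space (idx P))"
    using P cell_index[OF P] partition1_sets[OF P]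
    by (subst measurable_count_space_eq2) (auto simp: space_\<mu> h_partition_def)
  show "g \<in> measurable (count_space (idx P)) \<nu>" using g by (auto simp: space_\<nu>)
qed

text \<open>For a median, the triangle inequality through the target tags is averaged and the
  potential at the median is compared with the one at \<open>z\<close>. For a barycenter, convexity
  of the norm gives the bound even without the factor 2. Multiplying by the cell mass makes the
  bound trivial on null cells, where the value of \<open>S\<close> is unconstrained.\<close>

lemma projection_map_dist_le:
  assumes D: "h_plan X Y \<mu> \<nu> D" and i: "i \<in> idx (src D)" and z: "z \<in> Y"
    and S: "S \<in> projection_maps X Y \<iota> \<mu> Q D" and Q: "0 \<le> Q"
  shows "measure \<mu> (cell (src D) i) * dist (S (tag (src D) i)) z
    \<le> 2 * (\<Sum>j\<in>idx (tgt D). wt D i j * dist z (tag (tgt D) j)) + Q * mesh D * measure \<mu> (cell (src D) i)"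
proof -
  let ?J = "idx (tgt D)" and ?m = "measure \<mu> (cell (src D) i)" and ?y = "tag (tgt D)" and ?t = "S (tag (src D) i)"
  have w: "\<And>j. j \<in> ?J \<Longrightarrow> 0 \<le> wt D i j" "(\<Sum>j\<in>?J. wt D i j) = ?m"
    and h: "0 \<le> mesh D" and y: "\<And>j. j \<in> ?J \<Longrightarrow> ?y j \<in> Y"
    using D i by (auto simp: h_plan_def h_partition_def)
  have x: "tag (src D) i \<in> X" using D i by (auto simp: h_plan_def h_partition_def)
  have W: "0 \<le> (\<Sum>j\<in>?J. wt D i j * dist z (?y j))" using w by (intro sum_nonneg) auto
  show ?thesis
  proof (cases "?m = 0")
    case True
    then show ?thesis using W by simp
  next
    case False
    then have m: "0 < ?m" using measure_nonneg[of \<mu> "cell (src D) i"] by linarith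
    let ?V = "\<lambda>z. \<Sum>j\<in>?J. wt D i j / ?m * dist z (?y j)"
    have V0: "0 \<le> ?V u" for u using w m by (intro sum_nonneg mult_nonneg_nonneg divide_nonneg_pos) auto
    have w1: "(\<Sum>j\<in>?J. wt D i j / ?m) = 1" using w(2) m by (simp add: sum_divide_distrib[symmetric])
    have "dist ?t z \<le> 2 * ?V z + Q * mesh D"
    proof (cases "S \<in> GM_maps X Y \<mu> Q D")
      case True
      then have V: "?V ?t \<le> ?V z + Q * mesh D"
        using i m z by (auto simp: GM_maps_def approx_geometric_median_def)
      have "dist ?t z = (\<Sum>j\<in>?J. wt D i j / ?m * dist ?t z)"
        by (simp only: sum_distrib_right[symmetric] w1)
      also have "\<dots> \<le> (\<Sum>j\<in>?J. wt D i j / ?m * dist ?t (?y j) + wt D i j / ?m * dist z (?y j))"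
        using w m unfolding distrib_left[symmetric]
        by (intro sum_mono mult_left_mono dist_triangle2 divide_nonneg_pos) auto
      also have "\<dots> = ?V ?t + ?V z" by (rule sum.distrib)
      finally show ?thesis using V by simp
    next
      case False
      then have B: "S \<in> B_maps X Y \<iota> \<mu> D" using S by (simp add: projection_maps_def)
      then have n: "normed_via \<iota> Y" by (auto simp: B_maps_def split: if_splits)
      then have St: "\<iota> ?t = (\<Sum>j\<in>?J. (wt D i j / ?m) *\<^sub>R \<iota> (?y j))" and t: "?t \<in> Y"
        using B i m x measurable_space[of S "restrict_space borel X" "restrict_space borel Y" "tag (src D) i"]
        by (auto simp: B_maps_def cellwise_constant_def space_restrict_space)
      have "dist ?t z = norm (\<iota> ?t - \<iota> z)" using n t z by (auto simp: normed_via_def)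
      also have "\<iota> z = (\<Sum>j\<in>?J. (wt D i j / ?m) *\<^sub>R \<iota> z)"
        by (simp only: scaleR_sum_left[symmetric] w1 scaleR_one)
      also have "\<iota> ?t - \<dots> = (\<Sum>j\<in>?J. (wt D i j / ?m) *\<^sub>R (\<iota> (?y j) - \<iota> z))"
        unfolding St by (simp only: sum_subtractf scaleR_diff_right)
      also have "norm \<dots> \<le> (\<Sum>j\<in>?J. norm ((wt D i j / ?m) *\<^sub>R (\<iota> (?y j) - \<iota> z)))" by (rule norm_sum)
      also have "\<dots> = ?V z"
      proof (rule sum.cong[OF refl])
        fix j assume j: "j \<in> ?J"
        then have "norm (\<iota> (?y j) - \<iota> z) = dist z (?y j)"
          using n z y by (auto simp: normed_via_def norm_minus_commute)
        then show "norm ((wt D i j / ?m) *\<^sub>R (\<iota> (?y j) - \<iota> z)) = wt D i j / ?m * dist z (?y j)"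
          using w(1)[OF j] m by simp
      qed
      finally show ?thesis using V0[of z] Q h by (smt (verit) mult_nonneg_nonneg)
    qed
    then have "?m * dist ?t z \<le> ?m * (2 * ?V z + Q * mesh D)" using m by simp
    also have "?m * (2 * ?V z + Q * mesh D) = 2 * (?m * ?V z) + Q * mesh D * ?m" by (simp add: algebra_simps)
    also have "?m * ?V z = (\<Sum>j\<in>?J. wt D i j * dist z (?y j))"
      unfolding sum_distrib_left using m by (intro sum.cong refl) simp
    finally show ?thesis .
  qed
qed

text \<open>Compactness of \<open>Y\<close> yields exact medians. On a null cell the quotients are
  0, the potential vanishes, and the minimizer is just some point of \<open>Y\<close>.\<close>

lemma exists_GM_map:
  assumes D: "h_plan X Y \<mu> \<nu> D"
  obtains S where "S \<in> GM_maps X Y \<mu> 0 D"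
proof -
  have P: "h_partition X (mesh D) (src D)" using D by (simp add: h_plan_def)
  define V where "V i z = (\<Sum>j\<in>idx (tgt D). wt D i j / measure \<mu> (cell (src D) i) * dist z (tag (tgt D) j))" for i z
  have "\<exists>t\<in>Y. \<forall>z\<in>Y. V i t \<le> V i z" for i
    unfolding V_def by (intro continuous_attains_inf compact_Y Y_nonempty continuous_intros)
  then obtain t where t: "\<And>i. t i \<in> Y" "\<And>i z. z \<in> Y \<Longrightarrow> V i (t i) \<le> V i z" by metis
  define S where "S x = t (cell_index (src D) x)" for x
  have "S \<in> measurable \<mu> \<nu>" unfolding S_def by (rule piecewise_constant_measurable[OF P t(1)])
  then have "S \<in> measurable (restrict_space borel X) (restrict_space borel Y)"
    using sets_\<mu> sets_\<nu> by (simp cong: measurable_cong_sets)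
  moreover have "S x = t i" if "i \<in> idx (src D)" "x \<in> cell (src D) i" for x i
    using cell_index_eq[OF P that] by (simp add: S_def)
  moreover have "tag (src D) i \<in> cell (src D) i" if "i \<in> idx (src D)" for i
    using P that by (auto simp: h_partition_def)
  ultimately have "S \<in> GM_maps X Y \<mu> 0 D"
    using t by (auto simp: GM_maps_def cellwise_constant_def approx_geometric_median_def V_def)
  then show ?thesis by (rule that)
qed

text \<open>A cellwise constant map has the same value at all admissible tags of a cell, and the
  potentials involve the tags of the target only.\<close>

lemma GM_maps_retag:
  assumes "S \<in> GM_maps X Y \<mu> Q D" "\<And>i. i \<in> idx (src D) \<Longrightarrow> tg i \<in> cell (src D) i"
  shows "S \<in> GM_maps X Y \<mu> Q (D\<lparr>src := (src D)\<lparr>tag := tg\<rparr>\<rparr>)"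
  using assms by (auto simp: GM_maps_def cellwise_constant_def)

lemma matched_retag:
  assumes "matched D \<pi>" "\<And>i. i \<in> idx (src D) \<Longrightarrow> tg i \<in> cell (src D) i"
  shows "matched (D\<lparr>src := (src D)\<lparr>tag := tg\<rparr>\<rparr>) \<pi>"
  using assms by (simp add: matched_def h_plan_def h_partition_def)

text \<open>The chain leads from \<open>D\<close> to \<open>\<pi>\<close>, by optimality to a plan
  matched with the competitor, and from there to the competitor. Each of the two discretizations
  costs \<open>e\<close>.\<close>

lemma eps_optimal_discretization:
  assumes m: "matched D \<pi>" and opt: "optimal_plan X Y \<mu> \<nu> c \<pi>" and e: "0 < e"
    and close: "\<And>D' \<pi>'. matched D' \<pi>' \<Longrightarrow> mesh D' = mesh D \<Longrightarrow> \<bar>K_cost c (plan_measure X Y D') - K_cost c \<pi>'\<bar> \<le> e"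
  shows "eps_optimal X Y \<mu> \<nu> c (2 * e) D"
  unfolding eps_optimal_def
proof (intro conjI allI impI)
  show "0 \<le> 2 * e" "h_plan X Y \<mu> \<nu> D" using e m by (auto simp: matched_def)
  fix w assume "h_plan X Y \<mu> \<nu> (D\<lparr>wt := w\<rparr>)"
  then obtain \<rho> where \<rho>: "matched (D\<lparr>wt := w\<rparr>) \<rho>" by (rule exists_matched_plan)
  then have "K_cost c \<pi> \<le> K_cost c \<rho>" by (intro optimal_cost_le[OF opt]) (simp add: matched_def)
  then show "K_cost c (plan_measure X Y D) \<le> 2 * e + K_cost c (plan_measure X Y (D\<lparr>wt := w\<rparr>))"
    using close[OF m] close[OF \<rho>] by (simp add: abs_le_iff)
qed

text \<open>The chain leads from \<open>\<pi> k\<close> to \<open>D k\<close>, by almost optimality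
  to the discretization of \<open>\<rho>\<close> on the same partitions, and from there to
  \<open>\<rho>\<close>. The two discretizations and \<open>\<epsilon> k\<close> cost at most
  \<open>e / 3\<close> each.\<close>

lemma near_optimal_matched:
  assumes seq: "approx_plan_seq X Y \<mu> \<nu> c D" and m: "\<And>k. matched (D k) (\<pi> k)"
    and \<rho>: "\<rho> \<in> transport_plans X Y \<mu> \<nu>" and e: "0 < e"
  shows "\<forall>\<^sub>F k in sequentially. K_cost c (\<pi> k) \<le> K_cost c \<rho> + e"
proof -
  obtain \<epsilon> where \<epsilon>: "\<epsilon> \<longlonglongrightarrow> 0" "\<And>k. eps_optimal X Y \<mu> \<nu> c (\<epsilon> k) (D k)" and h: "(\<lambda>k. mesh (D k)) \<longlonglongrightarrow> 0"
    using seq by (auto simp: approx_plan_seq_def)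
  obtain \<delta> where \<delta>: "0 < \<delta>"
    "\<And>D \<pi>. matched D \<pi> \<Longrightarrow> mesh D < \<delta> \<Longrightarrow> \<bar>K_cost c (plan_measure X Y D) - K_cost c \<pi>\<bar> \<le> e / 3"
    using cost_matched[of "e / 3"] e by auto
  have "\<forall>\<^sub>F k in sequentially. mesh (D k) < \<delta>" using h \<delta>(1) by (rule order_tendstoD)
  moreover have "\<forall>\<^sub>F k in sequentially. \<epsilon> k < e / 3" using \<epsilon>(1) by (rule order_tendstoD) (use e in simp)
  ultimately show ?thesis
  proof eventually_elim
    case (elim k)
    define w where "w = (\<lambda>i j. measure \<rho> (cell (src (D k)) i \<times> cell (tgt (D k)) j))"
    have *: "matched ((D k)\<lparr>wt := w\<rparr>) \<rho>" unfolding w_def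
      by (rule matched_discretization[OF _ _ \<rho>]) (use m[of k] in \<open>auto simp: matched_def h_plan_def\<close>)
    then have "K_cost c (plan_measure X Y (D k)) \<le> \<epsilon> k + K_cost c (plan_measure X Y ((D k)\<lparr>wt := w\<rparr>))"
      using \<epsilon>(2)[of k] by (auto simp: eps_optimal_def matched_def)
    moreover have "\<bar>K_cost c (plan_measure X Y ((D k)\<lparr>wt := w\<rparr>)) - K_cost c \<rho>\<bar> \<le> e / 3"
      by (rule \<delta>(2)[OF *]) (use elim in simp)
    ultimately show ?case using \<delta>(2)[OF m elim(1)] elim by linarith
  qed
qed

end

section \<open>Almost everywhere continuity implies convergence\<close>

lemma disc_1: "disc 1 \<mu> P S T = (\<Sum>i\<in>idx P. measure \<mu> (cell P i) * dist (S (tag P i)) (T (tag P i)))"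
  unfolding disc_def by (simp add: sum_nonneg)

text \<open>Bounded distances make all exponents equivalent to \<open>p = 1\<close>.\<close>

lemma disc_tendsto_0:
  assumes lim: "(\<lambda>k. disc 1 \<mu> (P k) (S k) T) \<longlonglongrightarrow> 0" and p: "1 \<le> p"
    and b: "\<And>k i. i \<in> idx (P k) \<Longrightarrow> dist (S k (tag (P k) i)) (T (tag (P k) i)) \<le> b"
  shows "(\<lambda>k. disc p \<mu> (P k) (S k) T) \<longlonglongrightarrow> 0"
proof -
  let ?d = "\<lambda>k i. dist (S k (tag (P k) i)) (T (tag (P k) i))"
  let ?s = "\<lambda>k. \<Sum>i\<in>idx (P k). measure \<mu> (cell (P k) i) * ?d k i powr p"
  have nn: "0 \<le> ?s k" for k by (intro sum_nonneg) auto
  have le: "?s k \<le> b powr (p - 1) * disc 1 \<mu> (P k) (S k) T" for k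
    unfolding disc_1 sum_distrib_left
  proof (rule sum_mono)
    fix i assume i: "i \<in> idx (P k)"
    have "?d k i powr p = ?d k i powr (p - 1) * ?d k i"
      using powr_add[of "?d k i" "p - 1" 1] by simp
    also have "\<dots> \<le> b powr (p - 1) * ?d k i"
      using b[OF i] p by (intro mult_right_mono powr_mono2) auto
    finally show "measure \<mu> (cell (P k) i) * ?d k i powr p \<le> b powr (p - 1) * (measure \<mu> (cell (P k) i) * ?d k i)"
      using mult_left_mono[of _ _ "measure \<mu> (cell (P k) i)"] by (fastforce simp: mult.left_commute)
  qed
  have "(\<lambda>k. b powr (p - 1) * disc 1 \<mu> (P k) (S k) T) \<longlonglongrightarrow> 0"
    using tendsto_mult_right_zero[OF lim] by simp
  then have "?s \<longlonglongrightarrow> 0" by (rule tendsto_sandwich[OF _ _ tendsto_const, rotated 2]) (use nn le in auto)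
  then show ?thesis unfolding disc_def
    by (rule tendsto_zero_powrI[OF _ tendsto_const]) (use nn p in auto)
qed

context optimal_transport_map
begin

text \<open>Within \<open>X\<close> these are, up to the borderline value, the points where the
  oscillation of \<open>T\<close> is below \<open>e\<close>. As a union of open sets it is open
  whatever \<open>T\<close> is; it also contains all points outside the closed set
  \<open>X\<close>.\<close>

definition small_osc :: "real \<Rightarrow> 'a set"
  where "small_osc e = \<Union>{V. open V \<and> (\<forall>y\<in>V \<inter> X. \<forall>z\<in>V \<inter> X. dist (T y) (T z) < e)}"

lemma open_small_osc: "open (small_osc e)"
  unfolding small_osc_def by (intro open_Union) auto

text \<open>The discontinuity set becomes a countable union of closed sets. It is therefore Borel
  for every \<open>T\<close>, and its measure can be tested on one level of oscillation at a
  time.\<close>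

lemma discontinuities_eq: "discontinuities X T = (\<Union>n. X - small_osc (inverse (Suc n)))"
proof (intro equalityI subsetI)
  fix x assume x: "x \<in> discontinuities X T"
  show "x \<in> (\<Union>n. X - small_osc (inverse (Suc n)))"
  proof (rule ccontr)
    assume *: "x \<notin> (\<Union>n. X - small_osc (inverse (Suc n)))"
    have xX: "x \<in> X" using x by (simp add: discontinuities_def)
    have "continuous (at x within X) T" unfolding continuous_within_eps_delta
    proof (intro allI impI)
      fix e :: real assume "0 < e"
      then obtain n where n: "inverse (Suc n) < e" using reals_Archimedean by blast
      from * xX have "x \<in> small_osc (inverse (Suc n))" by auto
      then obtain V where V: "open V" "x \<in> V" "\<forall>y\<in>V \<inter> X. \<forall>z\<in>V \<inter> X. dist (T y) (T z) < inverse (Suc n)"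
        by (auto simp: small_osc_def)
      obtain d where "0 < d" "ball x d \<subseteq> V" using V(1,2) by (metis open_contains_ball)
      moreover have "dist (T x') (T x) < e" if "x' \<in> X" "dist x' x < d" for x'
      proof -
        have "x' \<in> V" using that \<open>ball x d \<subseteq> V\<close> by (auto simp: dist_commute)
        then show ?thesis using V(2,3) xX that(1) n by (meson IntI less_trans)
      qed
      ultimately show "\<exists>d>0. \<forall>x'\<in>X. dist x' x < d \<longrightarrow> dist (T x') (T x) < e" by blast
    qed
    with x show False by (simp add: discontinuities_def)
  qed
next
  fix x assume "x \<in> (\<Union>n. X - small_osc (inverse (Suc n)))"
  then obtain n where n: "x \<in> X" "x \<notin> small_osc (inverse (Suc n))" by auto
  have "\<not> continuous (at x within X) T"
  proof
    assume *: "continuous (at x within X) T"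
    have "0 < inverse (real (Suc n)) / 2" by simp
    then obtain d where d: "0 < d" "\<And>x'. x' \<in> X \<Longrightarrow> dist x' x < d \<Longrightarrow> dist (T x') (T x) < inverse (Suc n) / 2"
      using * unfolding continuous_within_eps_delta by metis
    have "dist (T y) (T z) < inverse (Suc n)" if "y \<in> ball x d \<inter> X" "z \<in> ball x d \<inter> X" for y z
      using d(2)[of y] d(2)[of z] that dist_triangle2[of "T y" "T z" "T x"] by (auto simp: dist_commute)
    then have "x \<in> small_osc (inverse (Suc n))"
      unfolding small_osc_def using d(1) by (intro UnionI[of "ball x d"]) auto
    with n(2) show False by simp
  qed
  then show "x \<in> discontinuities X T" using n(1) by (simp add: discontinuities_def)
qed

lemma large_osc_sets: "X - small_osc e \<in> sets \<mu>"
  using sets_restrict_borel_compact[OF compact_X] compact_imp_closed[OF compact_X] open_small_osc[of e]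
  by (auto simp: sets_\<mu> borel_closed closed_Diff)

text \<open>The tag of the cell of \<open>x\<close> lies within \<open>h k\<close> of
  \<open>x\<close>, so the integrand tends to 0 at each continuity point; the bound on distances in
  \<open>Y\<close> dominates it.\<close>

lemma tag_osc_tendsto_0:
  assumes null: "discontinuities X T \<in> null_sets \<mu>"
    and P: "\<And>k. h_partition X (h k) (P k)" and h: "h \<longlonglongrightarrow> 0"
  shows "(\<lambda>k. LINT x|\<mu>. dist (T x) (T (tag (P k) (cell_index (P k) x)))) \<longlonglongrightarrow> 0"
proof -
  obtain b where b: "0 < b" "\<And>y z. y \<in> Y \<Longrightarrow> z \<in> Y \<Longrightarrow> dist y z \<le> b" using dist_Y_bounded by auto
  have tagX: "i \<in> idx (P k) \<Longrightarrow> tag (P k) i \<in> X" for k i using P[of k] by (auto simp: h_partition_def)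
  have "(\<lambda>k. LINT x|\<mu>. dist (T x) (T (tag (P k) (cell_index (P k) x)))) \<longlonglongrightarrow> (LINT x|\<mu>. 0)"
  proof (rule integral_dominated_convergence[where w="\<lambda>_. b"])
    show "(\<lambda>x. dist (T x) (T (tag (P k) (cell_index (P k) x)))) \<in> borel_measurable \<mu>" for k
      by (intro dist_measurable T_measurable piecewise_constant_measurable[OF P, where g="\<lambda>i. T (tag (P k) i)"] T_in tagX)
    show "AE x in \<mu>. norm (dist (T x) (T (tag (P k) (cell_index (P k) x)))) \<le> b" for k
      using b(2) T_in tagX cell_index(1)[OF P[of k]] by (intro AE_I2) (auto simp: space_\<mu>)
    show "AE x in \<mu>. (\<lambda>k. dist (T x) (T (tag (P k) (cell_index (P k) x)))) \<longlonglongrightarrow> 0"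
      using AE_not_in[OF null]
    proof (rule AE_mp, intro AE_I2 impI)
      fix x assume "x \<in> space \<mu>" "x \<notin> discontinuities X T"
      then have x: "x \<in> X" "continuous (at x within X) T" by (auto simp: discontinuities_def space_\<mu>)
      show "(\<lambda>k. dist (T x) (T (tag (P k) (cell_index (P k) x)))) \<longlonglongrightarrow> 0"
      proof (rule tendstoI)
        fix e :: real assume "0 < e"
        then obtain d where d: "0 < d" "\<And>x'. x' \<in> X \<Longrightarrow> dist x' x < d \<Longrightarrow> dist (T x') (T x) < e"
          using x(2) unfolding continuous_within_eps_delta by metis
        have "\<forall>\<^sub>F k in sequentially. h k < d" using h d(1) by (rule order_tendstoD)
        then show "\<forall>\<^sub>F k in sequentially. dist (dist (T x) (T (tag (P k) (cell_index (P k) x)))) 0 < e"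
        proof eventually_elim
          case (elim k)
          note i = cell_index[OF P[of k] x(1)]
          have "tag (P k) (cell_index (P k) x) \<in> cell (P k) (cell_index (P k) x)"
            using P[of k] i by (auto simp: h_partition_def)
          then have "dist (tag (P k) (cell_index (P k) x)) x \<le> h k" using h_partition_dist_le[OF compact_X P i(1) _ i(2)] by blast
          then show ?case using d(2)[OF tagX[OF i(1)]] elim by (simp add: dist_commute)
        qed
      qed
    qed
  qed auto
  then show ?thesis by simp
qed

lemma disc_1_tendsto_0:
  assumes null: "discontinuities X T \<in> null_sets \<mu>" and seq: "approx_map_seq X Y \<iota> \<mu> \<nu> c D S"
  shows "(\<lambda>k. disc 1 \<mu> (src (D k)) (S k) T) \<longlonglongrightarrow> 0"
proof -
  obtain Q where plans: "approx_plan_seq X Y \<mu> \<nu> c D" and Q: "0 \<le> Q"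
    and S: "\<And>k. S k \<in> projection_maps X Y \<iota> \<mu> Q (D k)"
    using seq by (auto simp: approx_map_seq_def)
  have D: "h_plan X Y \<mu> \<nu> (D k)" for k using plans by (auto simp: approx_plan_seq_def eps_optimal_def)
  have h: "(\<lambda>k. mesh (D k)) \<longlonglongrightarrow> 0" using plans by (simp add: approx_plan_seq_def)
  have P: "h_partition X (mesh (D k)) (src (D k))" and R: "h_partition Y (mesh (D k)) (tgt (D k))" for k
    using D[of k] by (auto simp: h_plan_def)
  have "\<exists>\<pi>. matched (D k) \<pi>" for k by (meson exists_matched_plan[OF D])
  then obtain \<pi> where m: "\<And>k. matched (D k) (\<pi> k)" by metis
  have \<pi>: "\<pi> k \<in> transport_plans X Y \<mu> \<nu>" for k using m[of k] by (simp add: matched_def)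
  let ?f = "\<lambda>k. LINT z|\<pi> k. dist (snd z) (T (fst z))"
  let ?g = "\<lambda>k x. dist (T x) (T (tag (src (D k)) (cell_index (src (D k)) x)))"
  have f: "?f \<longlonglongrightarrow> 0"
    by (rule dist_map_tendsto_0[OF \<pi> near_optimal_matched[OF plans m \<pi>star_plan]])
  have g: "(\<lambda>k. LINT x|\<mu>. ?g k x) \<longlonglongrightarrow> 0" by (rule tag_osc_tendsto_0[OF null P h])
  \<comment> \<open>The path from \<open>T\<close> at the source tag to the target tag runs through
    \<open>T x\<close> and \<open>y\<close>; its three pieces integrate to at most the
    \<open>?g\<close> term, \<open>?f k\<close> and the mesh. The remaining factor 2 and the
    \<open>Q\<close> term come from \<open>projection_map_dist_le\<close> with
    \<open>z = T (?x i)\<close>.\<close>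
  have le: "disc 1 \<mu> (src (D k)) (S k) T \<le> 2 * (mesh (D k) + ?f k + (LINT x|\<mu>. ?g k x)) + Q * mesh (D k)" for k
  proof -
    let ?I = "idx (src (D k))" and ?J = "idx (tgt (D k))" and ?E = "cell (src (D k))"
      and ?x = "tag (src (D k))" and ?y = "tag (tgt (D k))"
    interpret \<pi>: prob_space "\<pi> k" by (rule plan_prob[OF \<pi>])
    have xI: "?x i \<in> X" "?x i \<in> ?E i" if "i \<in> ?I" for i using P[of k] that by (auto simp: h_partition_def)
    have gm: "?g k \<in> borel_measurable \<mu>"
      by (intro dist_measurable T_measurable piecewise_constant_measurable[OF P, where g="\<lambda>i. T (?x i)"] T_in xI)
    obtain b where b: "0 < b" "\<And>y z. y \<in> Y \<Longrightarrow> z \<in> Y \<Longrightarrow> dist y z \<le> b" using dist_Y_bounded by auto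
    have gi: "integrable (\<pi> k) (\<lambda>z. ?g k (fst z))"
      using measurable_compose[OF plan_fst[OF \<pi>[of k]] gm] b(2) T_in xI(1) cell_index(1)[OF P[of k]]
      by (intro \<pi>.integrable_const_bound[of _ b]) (auto simp: plan_space[OF \<pi>[of k]])
    \<comment> \<open>This term depends on the first coordinate only, so its integral passes to the
      fixed marginal \<mu>, where \<open>tag_osc_tendsto_0\<close> applies.\<close>
    have "(LINT z|\<pi> k. ?g k (fst z)) = (LINT x|distr (\<pi> k) \<mu> fst. ?g k x)"
      by (rule integral_distr[OF plan_fst[OF \<pi>] gm, symmetric])
    then have gint: "(LINT z|\<pi> k. ?g k (fst z)) = (LINT x|\<mu>. ?g k x)" by (simp add: plan_distr_fst'[OF \<pi>])
    have "(\<Sum>i\<in>?I. \<Sum>j\<in>?J. wt (D k) i j * dist (T (?x i)) (?y j))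
        \<le> (LINT z|\<pi> k. mesh (D k) + dist (snd z) (T (fst z)) + ?g k (fst z))"
    proof (rule matched_sum_le_integral[OF m])
      show "integrable (\<pi> k) (\<lambda>z. mesh (D k) + dist (snd z) (T (fst z)) + ?g k (fst z))"
        using gi integrable_dist_map[OF \<pi>] by simp
      fix i j x y assume ij: "i \<in> ?I" "j \<in> ?J" "x \<in> ?E i" "y \<in> cell (tgt (D k)) j"
      have "dist (?y j) y \<le> mesh (D k)"
        using h_partition_dist_le[OF compact_Y R ij(2) _ ij(4)] R[of k] ij(2) by (auto simp: h_partition_def)
      moreover have "dist (T (?x i)) (?y j) \<le> dist (?y j) y + dist y (T x) + dist (T x) (T (?x i))"
        using dist_triangle[of "T (?x i)" "?y j" y] dist_triangle[of "T (?x i)" y "T x"]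
        by (simp add: dist_commute)
      ultimately show "dist (T (?x i)) (?y j) \<le> mesh (D k) + dist (snd (x, y)) (T (fst (x, y))) + ?g k (fst (x, y))"
        using cell_index_eq[OF P ij(1,3)] by simp
    qed
    also have "\<dots> = mesh (D k) + ?f k + (LINT x|\<mu>. ?g k x)"
      using gi integrable_dist_map[OF \<pi>[of k]] gint by (simp add: \<pi>.prob_space)
    finally have 1: "(\<Sum>i\<in>?I. \<Sum>j\<in>?J. wt (D k) i j * dist (T (?x i)) (?y j)) \<le> mesh (D k) + ?f k + (LINT x|\<mu>. ?g k x)" .
    have "disc 1 \<mu> (src (D k)) (S k) T \<le>
        (\<Sum>i\<in>?I. 2 * (\<Sum>j\<in>?J. wt (D k) i j * dist (T (?x i)) (?y j)) + Q * mesh (D k) * measure \<mu> (?E i))"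
      unfolding disc_1 using xI by (intro sum_mono projection_map_dist_le[OF D _ _ S Q] T_in)
    also have "\<dots> = 2 * (\<Sum>i\<in>?I. \<Sum>j\<in>?J. wt (D k) i j * dist (T (?x i)) (?y j)) + Q * mesh (D k) * (\<Sum>i\<in>?I. measure \<mu> (?E i))"
      by (simp only: sum.distrib sum_distrib_left)
    also have "(\<Sum>i\<in>?I. measure \<mu> (?E i)) = (\<Sum>i\<in>?I. measure \<mu> (X \<inter> ?E i))"
      using P[of k] by (intro sum.cong refl arg_cong[where f="measure \<mu>"]) (auto simp: h_partition_def)
    also have "\<dots> = 1" using sum_cells1[OF P X_sets] \<mu>.prob_space by (simp add: space_\<mu>)
    finally show ?thesis using 1 by simp
  qed
  have nn: "0 \<le> disc 1 \<mu> (src (D k)) (S k) T" for k unfolding disc_1 by (intro sum_nonneg) auto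
  have "(\<lambda>k. 2 * (mesh (D k) + ?f k + (LINT x|\<mu>. ?g k x)) + Q * mesh (D k)) \<longlonglongrightarrow> 2 * (0 + 0 + 0) + Q * 0"
    by (intro tendsto_intros h f g)
  then have "(\<lambda>k. 2 * (mesh (D k) + ?f k + (LINT x|\<mu>. ?g k x)) + Q * mesh (D k)) \<longlonglongrightarrow> 0" by simp
  then show ?thesis
    by (rule tendsto_sandwich[OF _ _ tendsto_const, rotated 2]) (use le nn in \<open>auto intro!: always_eventually\<close>)
qed

lemma disc_p_tendsto_0:
  assumes null: "discontinuities X T \<in> null_sets \<mu>" and seq: "approx_map_seq X Y \<iota> \<mu> \<nu> c D S" and p: "1 \<le> p"
  shows "(\<lambda>k. disc p \<mu> (src (D k)) (S k) T) \<longlonglongrightarrow> 0"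
proof -
  obtain b where b: "0 < b" "\<And>y z. y \<in> Y \<Longrightarrow> z \<in> Y \<Longrightarrow> dist y z \<le> b" using dist_Y_bounded by auto
  have "S k x \<in> Y" if "x \<in> X" for k x
  proof -
    have "S k \<in> measurable (restrict_space borel X) (restrict_space borel Y)"
      using seq by (auto simp: approx_map_seq_def projection_maps_def GM_maps_def B_maps_def cellwise_constant_def split: if_splits)
    from measurable_space[OF this] that show ?thesis by (simp add: space_restrict_space)
  qed
  moreover have "tag (src (D k)) i \<in> X" if "i \<in> idx (src (D k))" for k i
  proof -
    have "h_plan X Y \<mu> \<nu> (D k)" using seq by (auto simp: approx_map_seq_def approx_plan_seq_def eps_optimal_def)
    then show ?thesis using that by (auto simp: h_plan_def h_partition_def)
  qed
  ultimately show ?thesis using b(2) T_in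
    by (intro disc_tendsto_0[OF disc_1_tendsto_0[OF null seq] p, of b]) auto
qed

end

section \<open>Convergence implies almost everywhere continuity\<close>

context optimal_transport_map
begin

text \<open>Two discretizations of the optimal plan that differ only in the tags admit the same projection map.
  On each cell of oscillation at least \<open>e\<close> the tags are chosen to realize it.\<close>

lemma exists_oscillating_sequences:
  fixes \<iota> :: "'b \<Rightarrow> 'v::real_normed_vector"
  assumes e: "0 < e"
  obtains D D' S where "approx_map_seq X Y \<iota> \<mu> \<nu> c D S" "approx_map_seq X Y \<iota> \<mu> \<nu> c D' S"
    "\<And>k. e * measure \<mu> (X - small_osc e) \<le> disc 1 \<mu> (src (D k)) (S k) T + disc 1 \<mu> (src (D' k)) (S k) T"
proof -
  define \<epsilon> where "\<epsilon> k = inverse (real (Suc k))" for k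
  have \<epsilon>: "0 < \<epsilon> k" for k by (simp add: \<epsilon>_def)
  have \<epsilon>0: "\<epsilon> \<longlonglongrightarrow> 0" unfolding \<epsilon>_def by (rule LIMSEQ_inverse_real_of_nat)
  have step: "\<exists>D D' S. mesh D \<le> \<epsilon> k \<and> mesh D' = mesh D \<and> eps_optimal X Y \<mu> \<nu> c (2 * \<epsilon> k) D \<and>
      eps_optimal X Y \<mu> \<nu> c (2 * \<epsilon> k) D' \<and> S \<in> GM_maps X Y \<mu> 0 D \<and> S \<in> GM_maps X Y \<mu> 0 D' \<and>
      e * measure \<mu> (X - small_osc e) \<le> disc 1 \<mu> (src D) S T + disc 1 \<mu> (src D') S T" for k
  proof -
    obtain \<delta> where \<delta>: "0 < \<delta>"
      "\<And>D \<pi>. matched D \<pi> \<Longrightarrow> mesh D < \<delta> \<Longrightarrow> \<bar>K_cost c (plan_measure X Y D) - K_cost c \<pi>\<bar> \<le> \<epsilon> k"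
      using cost_matched[OF \<epsilon>] by blast
    \<comment> \<open>Below \<open>\<delta>\<close> for the cost estimate, and at most
      \<open>\<epsilon> k\<close> so that the meshes tend to 0.\<close>
    define h where "h = min (\<delta> / 2) (\<epsilon> k)"
    have h: "0 < h" "h < \<delta>" "h \<le> \<epsilon> k" using \<delta>(1) \<epsilon>[of k] by (auto simp: h_def)
    obtain P N where P: "h_partition X h P" and N: "N \<in> null_sets \<mu>"
      and int: "\<And>x. x \<in> X - N \<Longrightarrow> \<exists>i\<in>idx P. \<exists>U. open U \<and> x \<in> U \<and> U \<inter> X \<subseteq> cell P i"
      using exists_h_partition[OF compact_X \<mu>.finite_measure_axioms sets_\<mu> h(1)] by metis
    obtain R where R: "h_partition Y h R"
      using exists_h_partition[OF compact_Y \<nu>.finite_measure_axioms sets_\<nu> h(1)] by metis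
    define J where "J = {i \<in> idx P. \<exists>y\<in>cell P i. \<exists>z\<in>cell P i. e \<le> dist (T y) (T z)}"
    have tagP: "\<And>i. i \<in> idx P \<Longrightarrow> tag P i \<in> cell P i" using P by (simp add: h_partition_def)
    \<comment> \<open>Outside \<open>J\<close> the old tag can serve as both new ones.\<close>
    have "\<forall>i\<in>idx P. \<exists>y z. y \<in> cell P i \<and> z \<in> cell P i \<and> (i \<in> J \<longrightarrow> e \<le> dist (T y) (T z))"
    proof
      fix i assume i: "i \<in> idx P"
      show "\<exists>y z. y \<in> cell P i \<and> z \<in> cell P i \<and> (i \<in> J \<longrightarrow> e \<le> dist (T y) (T z))"
      proof (cases "i \<in> J")
        case True
        then show ?thesis unfolding J_def by blast
      next
        case False
        then show ?thesis using tagP[OF i] by blast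
      qed
    qed
    then obtain y z where yz: "\<And>i. i \<in> idx P \<Longrightarrow> y i \<in> cell P i" "\<And>i. i \<in> idx P \<Longrightarrow> z i \<in> cell P i"
      "\<And>i. i \<in> idx P \<Longrightarrow> i \<in> J \<Longrightarrow> e \<le> dist (T (y i)) (T (z i))" by metis
    define D0 where "D0 = \<lparr>mesh = h, src = P, tgt = R, wt = \<lambda>i j. measure \<pi>star (cell P i \<times> cell R j)\<rparr>"
    define D where "D = D0\<lparr>src := P\<lparr>tag := y\<rparr>\<rparr>"
    define D' where "D' = D0\<lparr>src := P\<lparr>tag := z\<rparr>\<rparr>"
    have m0: "matched D0 \<pi>star"
      using matched_discretization[of "\<lparr>mesh = h, src = P, tgt = R, wt = \<lambda>_ _. 0\<rparr>", OF _ _ \<pi>star_plan] P R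
      by (simp add: D0_def)
    have mD: "matched D \<pi>star" "matched D' \<pi>star"
      using matched_retag[OF m0, of y] matched_retag[OF m0, of z] yz by (simp_all add: D_def D'_def D0_def)
    have mesh: "mesh D = h" "mesh D' = h" by (simp_all add: D_def D'_def D0_def)
    have opt: "eps_optimal X Y \<mu> \<nu> c (2 * \<epsilon> k) D" "eps_optimal X Y \<mu> \<nu> c (2 * \<epsilon> k) D'"
      using \<delta>(2) h mesh by (auto intro!: eps_optimal_discretization[OF _ \<pi>star_optimal \<epsilon>] mD)
    obtain S where S0: "S \<in> GM_maps X Y \<mu> 0 D0" using exists_GM_map[of D0] m0 by (auto simp: matched_def)
    then have S: "S \<in> GM_maps X Y \<mu> 0 D" "S \<in> GM_maps X Y \<mu> 0 D'"
      using GM_maps_retag[OF S0, of y] GM_maps_retag[OF S0, of z] yz by (simp_all add: D_def D'_def D0_def)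
    have Sc: "S x = S x'" if "i \<in> idx P" "x \<in> cell P i" "x' \<in> cell P i" for i x x'
      using S0 that by (simp add: GM_maps_def cellwise_constant_def D0_def)
    have finJ: "finite J" and JP: "J \<subseteq> idx P" using P by (auto simp: J_def h_partition_def)
    \<comment> \<open>A point off \<open>N\<close> has a neighbourhood inside its cell; if that cell
      is not in \<open>J\<close>, the neighbourhood puts the point into
      \<open>small_osc e\<close>.\<close>
    have sub: "X - small_osc e \<subseteq> N \<union> (\<Union>i\<in>J. cell P i)"
    proof
      fix x assume x: "x \<in> X - small_osc e"
      show "x \<in> N \<union> (\<Union>i\<in>J. cell P i)"
      proof (rule ccontr)
        assume *: "x \<notin> N \<union> (\<Union>i\<in>J. cell P i)"
        then obtain i U where U: "i \<in> idx P" "open U" "x \<in> U" "U \<inter> X \<subseteq> cell P i" using int x by blast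
        then have "i \<notin> J" using * x by blast
        then have "\<forall>y\<in>U \<inter> X. \<forall>z\<in>U \<inter> X. dist (T y) (T z) < e"
          using U(1,4) unfolding J_def by (force simp: not_le)
        then have "x \<in> small_osc e" using U(2,3) by (auto simp: small_osc_def)
        with x show False by simp
      qed
    qed
    have Jm: "cell P i \<in> sets \<mu>" if "i \<in> J" for i using partition1_sets[OF P] JP that by blast
    have "measure \<mu> (X - small_osc e) \<le> measure \<mu> (N \<union> (\<Union>i\<in>J. cell P i))"
      using sub N finJ Jm by (intro \<mu>.finite_measure_mono) auto
    also have "\<dots> \<le> measure \<mu> N + measure \<mu> (\<Union>i\<in>J. cell P i)"
      using N finJ Jm by (intro measure_Un_le) auto
    also have "measure \<mu> N = 0" using N by (simp add: measure_eq_0_null_sets)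
    also have "measure \<mu> (\<Union>i\<in>J. cell P i) \<le> (\<Sum>i\<in>J. measure \<mu> (cell P i))"
      using finJ Jm by (intro measure_UNION_le) auto
    finally have le: "measure \<mu> (X - small_osc e) \<le> (\<Sum>i\<in>J. measure \<mu> (cell P i))" by simp
    have "e * measure \<mu> (X - small_osc e) \<le> (\<Sum>i\<in>J. measure \<mu> (cell P i) * e)"
      unfolding sum_distrib_right[symmetric] using mult_left_mono[OF le, of e] e by (simp add: mult.commute)
    also have "\<dots> \<le> (\<Sum>i\<in>J. measure \<mu> (cell P i) * dist (T (y i)) (T (z i)))"
      using yz(3) JP by (intro sum_mono mult_left_mono) auto
    also have "\<dots> \<le> (\<Sum>i\<in>idx P. measure \<mu> (cell P i) * dist (T (y i)) (T (z i)))"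
      using P JP by (intro sum_mono2) (auto simp: h_partition_def)
    also have "\<dots> \<le> (\<Sum>i\<in>idx P. measure \<mu> (cell P i) * dist (S (y i)) (T (y i)) + measure \<mu> (cell P i) * dist (S (z i)) (T (z i)))"
    proof (rule sum_mono)
      fix i assume i: "i \<in> idx P"
      \<comment> \<open>\<open>S\<close> has one value at both tags, and the triangle inequality
        passes through it.\<close>
      have "dist (T (y i)) (T (z i)) \<le> dist (S (y i)) (T (y i)) + dist (S (z i)) (T (z i))"
        using dist_triangle[of "T (y i)" "T (z i)" "S (y i)"] Sc[OF i yz(1,2)[OF i]] by (simp add: dist_commute)
      then show "measure \<mu> (cell P i) * dist (T (y i)) (T (z i)) \<le>
          measure \<mu> (cell P i) * dist (S (y i)) (T (y i)) + measure \<mu> (cell P i) * dist (S (z i)) (T (z i))"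
        unfolding distrib_left[symmetric] by (intro mult_left_mono) auto
    qed
    also have "\<dots> = disc 1 \<mu> (src D) S T + disc 1 \<mu> (src D') S T"
      by (simp add: disc_1 sum.distrib D_def D'_def)
    finally show ?thesis using h mesh opt S by (intro exI[of _ D] exI[of _ D'] exI[of _ S]) simp
  qed
  then obtain D D' S where D: "\<And>k. mesh (D k) \<le> \<epsilon> k" "\<And>k. mesh (D' k) = mesh (D k)"
    "\<And>k. eps_optimal X Y \<mu> \<nu> c (2 * \<epsilon> k) (D k)" "\<And>k. eps_optimal X Y \<mu> \<nu> c (2 * \<epsilon> k) (D' k)"
    "\<And>k. S k \<in> GM_maps X Y \<mu> 0 (D k)" "\<And>k. S k \<in> GM_maps X Y \<mu> 0 (D' k)"
    "\<And>k. e * measure \<mu> (X - small_osc e) \<le> disc 1 \<mu> (src (D k)) (S k) T + disc 1 \<mu> (src (D' k)) (S k) T"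
    by metis
  have "0 \<le> mesh (D k)" for k using D(3)[of k] by (auto simp: eps_optimal_def h_plan_def h_partition_def)
  then have mesh: "(\<lambda>k. mesh (D k)) \<longlonglongrightarrow> 0"
    by (intro tendsto_sandwich[OF _ _ tendsto_const \<epsilon>0]) (use D(1) in auto)
  have \<epsilon>2: "(\<lambda>k. 2 * \<epsilon> k) \<longlonglongrightarrow> 0" using tendsto_mult_right_zero[OF \<epsilon>0, of 2] .
  have "approx_map_seq X Y \<iota> \<mu> \<nu> c D S" "approx_map_seq X Y \<iota> \<mu> \<nu> c D' S"
    using mesh D \<epsilon>2
    by (auto simp: approx_map_seq_def approx_plan_seq_def projection_maps_def intro!: exI[of _ "\<lambda>k. 2 * \<epsilon> k"])
  then show ?thesis using D(7) by (rule that)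
qed

text \<open>The oscillating sequences bound \<open>e * measure \<mu> (X - small_osc e)\<close>,
  which does not depend on \<open>k\<close>, by a sum of two discrepancies tending to 0. Their
  projection maps are geometric medians, so any \<open>\<iota>\<close> is admissible.\<close>

lemma discontinuities_null:
  fixes \<iota> :: "'b \<Rightarrow> 'v::real_normed_vector"
  assumes conv: "\<And>D S. approx_map_seq X Y \<iota> \<mu> \<nu> c D S \<Longrightarrow> (\<lambda>k. disc 1 \<mu> (src (D k)) (S k) T) \<longlonglongrightarrow> 0"
  shows "discontinuities X T \<in> null_sets \<mu>"
proof -
  have "X - small_osc e \<in> null_sets \<mu>" if e: "0 < e" for e
  proof -
    obtain D D' S where *: "approx_map_seq X Y \<iota> \<mu> \<nu> c D S" "approx_map_seq X Y \<iota> \<mu> \<nu> c D' S"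
      "\<And>k. e * measure \<mu> (X - small_osc e) \<le> disc 1 \<mu> (src (D k)) (S k) T + disc 1 \<mu> (src (D' k)) (S k) T"
      using exists_oscillating_sequences[OF e, where \<iota>=\<iota>] by metis
    have "(\<lambda>k. disc 1 \<mu> (src (D k)) (S k) T + disc 1 \<mu> (src (D' k)) (S k) T) \<longlonglongrightarrow> 0 + 0"
      by (intro tendsto_add conv *(1,2))
    then have "e * measure \<mu> (X - small_osc e) \<le> 0"
      by (intro tendsto_lowerbound[of _ 0 sequentially]) (use *(3) in auto)
    then have "measure \<mu> (X - small_osc e) = 0" using e by (simp add: mult_le_0_iff measure_le_0_iff)
    then show ?thesis using large_osc_sets by (intro null_setsI) (simp_all add: \<mu>.emeasure_eq_measure)
  qed
  then show ?thesis unfolding discontinuities_eq by (intro null_sets_UN) simp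
qed

end

text \<open>Membership in \<open>null_sets\<close> includes measurability, which holds automatically
  because the discontinuity set is a countable union of closed sets.\<close>

theorem corollaryB:
  fixes X :: "'a::metric_space set" and Y :: "'b::metric_space set"
    and \<mu> :: "'a measure" and \<nu> :: "'b measure" and c :: "'a \<times> 'b \<Rightarrow> real"
    and \<iota> :: "'b \<Rightarrow> 'v::real_normed_vector"
    and Tstar :: "'a \<Rightarrow> 'b"
  assumes "compact_OT_problem X Y \<mu> \<nu> c"
    and "strong_uniqueness X Y \<mu> \<nu> c"
    and "optimal_map X Y \<mu> \<nu> c Tstar"
  shows "discontinuities X Tstar \<in> null_sets \<mu> \<longleftrightarrow>
    (\<forall>D T. approx_map_seq X Y \<iota> \<mu> \<nu> c D T \<longrightarrow>
      (\<forall>p::real. 1 \<le> p \<longrightarrow> (\<lambda>k. disc p \<mu> (src (D k)) (T k) Tstar) \<longlonglongrightarrow> 0))"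
proof -
  interpret optimal_transport_map X Y \<mu> \<nu> c Tstar
    by unfold_locales (fact assms)+
  \<comment> \<open>For the implication from (ii) to (i) the exponent \<open>p = 1\<close>
    suffices.\<close>
  show ?thesis
    using disc_p_tendsto_0[where \<iota>=\<iota>] discontinuities_null[where \<iota>=\<iota>] by (meson order_refl)
qed

end
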